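(* Let $G$ be a connected unicyclic graph of order $n$ which is not a cycle, whose unique cycle has length $\ell\geq 6$. Then $trc(G)=2n-7$ if $G\in\{B_6\}\cup\mathcal{J}_1$; otherwise $trc(G)\leq 2n-9$.
   Context: All graphs are finite, simple and undirected. A total-coloring assigns colors to all vertices and edges; a path is total-rainbow if its edges and internal vertices receive pairwise distinct colors; $trc(G)$ is the minimum number of colors in a total-coloring of the connected graph $G$ such that every two distinct vertices are joined by a total-rainbow path. For a connected unicyclic graph $G$ with cycle $C_\ell=u_1u_2\cdots u_\ell u_1$, let $T_i$ ($1\le i\le \ell$) be the component containing $u_i$ of the graph obtained from $G$ by deleting the edges of $C_\ell$ (a tree rooted at $u_i$); $\mathcal{T}_G=\{T_1,\dots,T_\ell\}$, and $T_i$ is nontrivial if it contains at least one edge. $B_6$ denotes the graph of order $n$ consisting of a $6$-cycle $u_1\cdots u_6u_1$ together with a nontrivial path $T_1$ having $u_1$ as an end vertex and meeting the cycle only in $u_1$ (so only $T_1$ is nontrivial). $\mathcal{J}_1$ is the set of unicyclic graphs $G$ of order $n$ with cycle length $6$ such that $\mathcal{T}_G$ contains exactly two nontrivial elements and $diam(G)=n-3$. *)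

theory Defs
  imports "Graph_Theory.Graph_Theory"
begin

text \<open>
  A finite simple undirected graph is a \<^locale>\<open>pair_graph\<close>: finite, loop-free and with
  a symmetric arc relation. An undirected edge is the two-element set of ends of an arc, so
  that both orientations of an edge count as one edge and carry one color.
\<close>

definition edge_of :: "'a \<times> 'a \<Rightarrow> 'a set" where
  "edge_of e = {fst e, snd e}"

definition uedges :: "'a pair_pre_digraph \<Rightarrow> 'a set set" where
  "uedges G = edge_of ` parcs G"

definition path_edges :: "'a list \<Rightarrow> 'a set list" where
  "path_edges p = map edge_of (vwalk_arcs p)"


text \<open>A total-coloring colors the disjoint union of the vertex set and the edge set.\<close>

type_synonym 'a total_coloring = "'a + 'a set \<Rightarrow> nat"

definition num_colors :: "'a pair_pre_digraph \<Rightarrow> 'a total_coloring \<Rightarrow> nat" where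
  "num_colors G c = card (c ` (pverts G <+> uedges G))"

text \<open>The internal vertices of a path \<open>p\<close> are listed by \<open>butlast (tl p)\<close>.\<close>

definition total_rainbow :: "'a total_coloring \<Rightarrow> 'a list \<Rightarrow> bool" where
  "total_rainbow c p \<longleftrightarrow>
     distinct (map (\<lambda>v. c (Inl v)) (butlast (tl p)) @ map (\<lambda>e. c (Inr e)) (path_edges p))"

definition total_rainbow_connected :: "'a pair_pre_digraph \<Rightarrow> 'a total_coloring \<Rightarrow> bool" where
  "total_rainbow_connected G c \<longleftrightarrow>
     (\<forall>u\<in>pverts G. \<forall>v\<in>pverts G. u \<noteq> v \<longrightarrow>
        (\<exists>p. vpath p G \<and> hd p = u \<and> last p = v \<and> total_rainbow c p))"

definition trc :: "'a pair_pre_digraph \<Rightarrow> nat" where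
  "trc G = (LEAST k. \<exists>c. total_rainbow_connected G c \<and> num_colors G c = k)"


definition gdist :: "'a pair_pre_digraph \<Rightarrow> 'a \<Rightarrow> 'a \<Rightarrow> nat" where
  "gdist G u v = (LEAST k. \<exists>p. vpath p G \<and> hd p = u \<and> last p = v \<and> vwalk_length p = k)"

definition diam :: "'a pair_pre_digraph \<Rightarrow> nat" where
  "diam G = Max {gdist G u v | u v. u \<in> pverts G \<and> v \<in> pverts G}"


text \<open>
  A cycle \<open>u\<^sub>1 u\<^sub>2 \<dots> u\<^sub>l u\<^sub>1\<close> is given by the list \<open>[u\<^sub>1, \<dots>, u\<^sub>l]\<close>; as a subgraph it is determined
  by its edge set, which is the same for all rotations and reflections of the list. The
  library's \<open>cycle\<close> is not used because in a symmetric digraph it admits the closed walk of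
  length two along a single edge.
\<close>

definition ucycle :: "'a pair_pre_digraph \<Rightarrow> 'a list \<Rightarrow> bool" where
  "ucycle G us \<longleftrightarrow> 3 \<le> length us \<and> vpath us G \<and> (last us, hd us) \<in> parcs G"

definition cycle_edges :: "'a list \<Rightarrow> 'a set set" where
  "cycle_edges us = insert {last us, hd us} (set (path_edges us))"

definition connected_unicyclic :: "'a pair_pre_digraph \<Rightarrow> bool" where
  "connected_unicyclic G \<longleftrightarrow>
     pair_graph G \<and> Digraph_Component.connected (with_proj G) \<and>
     (\<exists>!C. \<exists>us. ucycle G us \<and> C = cycle_edges us)"

definition is_cycle_graph :: "'a pair_pre_digraph \<Rightarrow> bool" where
  "is_cycle_graph G \<longleftrightarrow>
     (\<exists>us. ucycle G us \<and> pverts G = set us \<and> uedges G = cycle_edges us)"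

definition del_cycle_edges :: "'a pair_pre_digraph \<Rightarrow> 'a list \<Rightarrow> 'a pair_pre_digraph" where
  "del_cycle_edges G us = G\<lparr>parcs := {e \<in> parcs G. edge_of e \<notin> cycle_edges us}\<rparr>"

text \<open>The component containing \<open>u\<close> of the graph without the edges of the cycle \<open>us\<close>.\<close>

definition hanging_tree ::
    "'a pair_pre_digraph \<Rightarrow> 'a list \<Rightarrow> 'a \<Rightarrow> ('a, 'a \<times> 'a) pre_digraph" where
  "hanging_tree G us u =
     (let H = with_proj (del_cycle_edges G us) in H \<restriction> {v. u \<rightarrow>\<^sup>*\<^bsub>H\<^esub> v})"

definition hanging_trees ::
    "'a pair_pre_digraph \<Rightarrow> 'a list \<Rightarrow> ('a, 'a \<times> 'a) pre_digraph set" where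
  "hanging_trees G us = hanging_tree G us ` set us"

definition nontrivial :: "('a, 'b) pre_digraph \<Rightarrow> bool" where
  "nontrivial T \<longleftrightarrow> arcs T \<noteq> {}"


text \<open>The isomorphism class of \<open>B\<^sub>6\<close>, on vertices of type \<open>'a\<close>; \<open>p\<close> is the path \<open>T\<^sub>1\<close>.\<close>

definition B6 :: "nat \<Rightarrow> 'a pair_pre_digraph set" where
  "B6 n = {G. pair_graph G \<and> card (pverts G) = n \<and>
     (\<exists>us p. length us = 6 \<and> distinct us \<and>
        2 \<le> length p \<and> distinct p \<and> hd p = hd us \<and> set us \<inter> set p = {hd us} \<and>
        pverts G = set us \<union> set p \<and> uedges G = cycle_edges us \<union> set (path_edges p))}"

definition J1 :: "nat \<Rightarrow> 'a pair_pre_digraph set" where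
  "J1 n = {G. connected_unicyclic G \<and> card (pverts G) = n \<and>
     (\<exists>us. ucycle G us \<and> length us = 6 \<and> card {T \<in> hanging_trees G us. nontrivial T} = 2) \<and>
     int (diam G) = int n - 3}"

end

theory Submission
  imports Defs
begin

text \<open>
  A connected unicyclic graph is its cycle together with a parent map on the other vertices. Give
  all tree edges and all non-leaf tree vertices private colors; leaves are never internal to a
  path, so they cost nothing. With \<open>K\<close> further colors on a cycle of length \<open>l\<close>, \<open>L\<close> leaves and
  \<open>n\<close> vertices this uses \<open>2 (n - l) - L + K\<close> colors, and it remains to color the \<open>2 l\<close> vertices
  and edges of the cycle so that any two trees are joined by an arc without repeated colors. The
  word of period \<open>l\<close> works unless two opposite trees are nontrivial, and for even \<open>l\<close> the word of
  period \<open>l + 1\<close> always works. For \<open>l \<le> 7\<close> and few leaves one saves further colors by reusing the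
  colors of one or two pendant edges on the cycle: only paths ending in those leaves have to avoid
  them. Conversely \<open>trc(G) \<ge> 2 diam(G) - 1\<close>, and the exceptional graphs have diameter \<open>n - 3\<close>.
\<close>

section \<open>Walks, rainbow paths and distances\<close>

lemma vwalk_arcs_eq_map: "vwalk_arcs p = map (\<lambda>i. (p ! i, p ! Suc i)) [0..<length p - 1]"
proof (induct p rule: vwalk_arcs.induct)
  case (3 x y xs)
  have "[0..<Suc (length xs)] = 0 # map Suc [0..<length xs]"
    by (subst upt_conv_Cons) (simp_all add: map_Suc_upt del: upt_Suc)
  then show ?case using 3 by (simp add: comp_def del: upt_Suc)
qed auto

lemma path_edges_eq_map: "path_edges p = map (\<lambda>i. {p ! i, p ! Suc i}) [0..<length p - 1]"
  by (simp add: path_edges_def vwalk_arcs_eq_map edge_of_def comp_def)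

lemma distinct_path_edges: "distinct p \<Longrightarrow> distinct (path_edges p)"
  by (auto simp: path_edges_eq_map distinct_map inj_on_def doubleton_eq_iff nth_eq_iff_index_eq)

lemma set_path_edges_join:
  "joinable p q \<Longrightarrow> set (path_edges (p \<oplus> q)) = set (path_edges p) \<union> set (path_edges q)"
  by (simp add: path_edges_def vwalk_join_arcs image_Un)

lemma set_path_edges_rev: "set (path_edges (rev p)) = set (path_edges p)"
  by (force simp: path_edges_def set_vwalk_arcs_rev edge_of_def)

lemma set_butlast_tl_subset:
  assumes "distinct p"
  shows "set (butlast (tl p)) \<subseteq> set p - {hd p, last p}"
proof (cases p)
  case (Cons x q)
  then show ?thesis using assms by (cases q rule: rev_cases) auto
qed simp

text \<open>The elements of a walk that a rainbow path along it has to color differently.\<close>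

definition inner_elements :: "'a list \<Rightarrow> ('a + 'a set) set" where
  "inner_elements p = Inl ` (set p - {hd p, last p}) \<union> Inr ` set (path_edges p)"

lemma inner_elements_rev: "inner_elements (rev p) = inner_elements p"
  by (auto simp: inner_elements_def set_path_edges_rev hd_rev last_rev)

lemma total_rainbow_if_inj_on:
  assumes "distinct p" "inj_on c (inner_elements p)"
  shows "total_rainbow c p"
proof -
  let ?zs = "map Inl (butlast (tl p)) @ map Inr (path_edges p)"
  have "distinct ?zs"
    using assms(1) by (auto simp: distinct_map distinct_tl distinct_butlast distinct_path_edges)
  moreover have "set ?zs \<subseteq> inner_elements p"
    using set_butlast_tl_subset[OF assms(1)] by (auto simp: inner_elements_def)
  ultimately have "distinct (map c ?zs)"
    using assms(2) by (simp add: distinct_map inj_on_subset del: map_append)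
  then show ?thesis by (simp add: total_rainbow_def comp_def)
qed

context pair_graph
begin

lemma doubleton_in_uedges_iff: "{x, y} \<in> uedges G \<longleftrightarrow> (x, y) \<in> parcs G"
  using arcs_symmetric by (force simp: uedges_def edge_of_def doubleton_eq_iff)

lemma finite_elements: "finite (pverts G <+> uedges G)"
  by (simp add: uedges_def)

lemma vwalk_iff_uedges:
  "vwalk p G \<longleftrightarrow> set p \<subseteq> pverts G \<and> set (path_edges p) \<subseteq> uedges G \<and> p \<noteq> []"
proof -
  have "edge_of e \<in> uedges G \<longleftrightarrow> e \<in> parcs G" for e
    using doubleton_in_uedges_iff[of "fst e" "snd e"] by (simp add: edge_of_def)
  then show ?thesis by (auto simp: vwalk_def path_edges_def)
qed

lemma inner_elements_subset: "vwalk p G \<Longrightarrow> inner_elements p \<subseteq> pverts G <+> uedges G"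
  by (auto simp: inner_elements_def vwalk_iff_uedges)

lemma vwalk_contains_vpath:
  assumes "vwalk p G"
  obtains q where "vpath q G" "hd q = hd p" "last q = last p"
    "set q \<subseteq> set p" "set (path_edges q) \<subseteq> set (path_edges p)"
proof -
  let ?H = "with_proj \<lparr>pverts = set p, parcs = set (vwalk_arcs p)\<rparr>"
  have "vwalk p ?H" using assms by (auto simp: vwalk_def)
  then have "vpath (vwalk_to_vpath p) ?H" by (rule vwalk_to_vpath_vpath)
  then have "set (vwalk_to_vpath p) \<subseteq> set p"
    "set (path_edges (vwalk_to_vpath p)) \<subseteq> set (path_edges p)"
    by (auto simp: vpath_def vwalk_def path_edges_def)
  then show ?thesis
    using that vwalk_to_vpath_vpath[OF assms] vwalk_to_vpath_hd vwalk_to_vpath_last by metis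
qed

lemma connected_imp_reachable:
  assumes "connected G" "x \<in> pverts G" "y \<in> pverts G"
  shows "x \<rightarrow>\<^sup>*\<^bsub>with_proj G\<^esub> y"
  using symmetric_connected_imp_strongly_connected[OF pair_sym_arcs assms(1)] assms(2,3)
  by (simp add: strongly_connected_def)

lemma vwalk_potential_le:
  fixes h :: "'a \<Rightarrow> int"
  assumes "vwalk p G" "\<And>x y. (x, y) \<in> parcs G \<Longrightarrow> h y \<le> h x + 1"
  shows "h (last p) - h (hd p) \<le> int (vwalk_length p)"
  using assms(1)
proof (induct p rule: vwalk_induct)
  case (Cons u v es)
  then show ?case using assms(2)[of u v] by simp
qed simp

lemma vwalk_length_le_num_colors:
  assumes "vpath p G" "total_rainbow c p"
  shows "2 * vwalk_length p \<le> num_colors G c + 1"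
proof -
  let ?cs = "map (\<lambda>v. c (Inl v)) (butlast (tl p)) @ map (\<lambda>e. c (Inr e)) (path_edges p)"
  have "vwalk p G" "distinct p" using assms(1) by auto
  then have "set ?cs \<subseteq> c ` (pverts G <+> uedges G)"
    using set_butlast_tl_subset[of p] by (fastforce simp: vwalk_iff_uedges)
  then have "card (set ?cs) \<le> num_colors G c"
    unfolding num_colors_def using finite_elements by (intro card_mono) auto
  moreover have "card (set ?cs) = length ?cs"
    using assms(2) distinct_card unfolding total_rainbow_def by blast
  ultimately show ?thesis by (simp add: path_edges_eq_map)
qed

definition rainbow_joined :: "('a + 'a set \<Rightarrow> 'c) \<Rightarrow> 'a \<Rightarrow> 'a \<Rightarrow> bool" where
  "rainbow_joined c x y \<longleftrightarrow>
     (\<exists>p. vwalk p G \<and> hd p = x \<and> last p = y \<and> inj_on c (inner_elements p))"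

lemma rainbow_joined_sym:
  assumes "rainbow_joined c x y"
  shows "rainbow_joined c y x"
proof -
  obtain p where "vwalk p G" "hd p = x" "last p = y" "inj_on c (inner_elements p)"
    using assms by (auto simp: rainbow_joined_def)
  then show ?thesis
    unfolding rainbow_joined_def using vwalk_rev_ex[OF pair_sym_arcs]
    by (intro exI[of _ "rev p"]) (simp add: inner_elements_rev hd_rev last_rev)
qed

text \<open>Colors of an arbitrary type can be renamed to natural numbers.\<close>

lemma ex_total_rainbow_coloring:
  fixes c :: "'a + 'a set \<Rightarrow> 'c"
  assumes joined: "\<And>x y. x \<in> pverts G \<Longrightarrow> y \<in> pverts G \<Longrightarrow> rainbow_joined c x y"
  obtains c' where "total_rainbow_connected G c'"
    "num_colors G c' = card (c ` (pverts G <+> uedges G))"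
proof
  let ?E = "pverts G <+> uedges G"
  define rename :: "'c \<Rightarrow> nat" where "rename = to_nat_on (c ` ?E)"
  have inj: "inj_on rename (c ` ?E)"
    unfolding rename_def using finite_elements by (intro inj_on_to_nat_on countable_finite) simp
  show "num_colors G (rename \<circ> c) = card (c ` ?E)"
    unfolding num_colors_def image_comp[symmetric] by (rule card_image[OF inj])
  show "total_rainbow_connected G (rename \<circ> c)"
    unfolding total_rainbow_connected_def
  proof (intro ballI impI)
    fix x y assume "x \<in> pverts G" "y \<in> pverts G"
    then obtain p where p: "vwalk p G" "hd p = x" "last p = y" "inj_on c (inner_elements p)"
      using joined by (auto simp: rainbow_joined_def)
    obtain q where q: "vpath q G" "hd q = x" "last q = y"
      and sub: "set q \<subseteq> set p" "set (path_edges q) \<subseteq> set (path_edges p)"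
      using vwalk_contains_vpath[OF p(1)] p(2,3) by metis
    have "inner_elements q \<subseteq> inner_elements p"
      unfolding inner_elements_def p(2,3) q(2,3) using sub by blast
    then have "inj_on c (inner_elements q)" using p(4) inj_on_subset by blast
    moreover have "inner_elements q \<subseteq> ?E" using q(1) by (intro inner_elements_subset) auto
    ultimately have "inj_on (rename \<circ> c) (inner_elements q)"
      using inj by (meson comp_inj_on image_mono inj_on_subset)
    then have "total_rainbow (rename \<circ> c) q" using q(1) by (auto intro: total_rainbow_if_inj_on)
    then show "\<exists>p. vpath p G \<and> hd p = x \<and> last p = y \<and> total_rainbow (rename \<circ> c) p"
      using q by blast
  qed
qed

lemma trc_le_card_colors:
  fixes c :: "'a + 'a set \<Rightarrow> 'c"
  assumes "\<And>x y. x \<in> pverts G \<Longrightarrow> y \<in> pverts G \<Longrightarrow> rainbow_joined c x y"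
  shows "trc G \<le> card (c ` (pverts G <+> uedges G))"
  using ex_total_rainbow_coloring[OF assms]
  unfolding trc_def by (metis (mono_tags, lifting) Least_le)

lemma trc_attained:
  assumes "connected G"
  obtains c where "total_rainbow_connected G c" "num_colors G c = trc G"
proof -
  have "rainbow_joined id x y" if "x \<in> pverts G" "y \<in> pverts G" for x y
    using connected_imp_reachable[OF assms that]
    by (auto simp: rainbow_joined_def reachable_vwalk_conv)
  then obtain c :: "'a total_coloring" where "total_rainbow_connected G c"
    using ex_total_rainbow_coloring[of id] by blast
  then have "\<exists>k c. total_rainbow_connected G c \<and> num_colors G c = k" by blast
  from LeastI_ex[OF this] show ?thesis using that unfolding trc_def by blast
qed

lemma gdist_le_vwalk_length: "vpath p G \<Longrightarrow> gdist G (hd p) (last p) \<le> vwalk_length p"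
  unfolding gdist_def by (rule Least_le) blast

lemma le_gdistI:
  assumes "connected G" "u \<in> pverts G" "v \<in> pverts G"
    and "\<And>p. vpath p G \<Longrightarrow> hd p = u \<Longrightarrow> last p = v \<Longrightarrow> k \<le> vwalk_length p"
  shows "k \<le> gdist G u v"
proof -
  have "\<exists>p. vpath p G \<and> hd p = u \<and> last p = v"
    using connected_imp_reachable[OF assms(1-3)] by (simp add: reachable_vpath_conv)
  then have "\<exists>k p. vpath p G \<and> hd p = u \<and> last p = v \<and> vwalk_length p = k" by blast
  from LeastI_ex[OF this] show ?thesis using assms(4) unfolding gdist_def by metis
qed

lemma finite_gdists: "finite {gdist G u v | u v. u \<in> pverts G \<and> v \<in> pverts G}"
  by (simp add: finite_image_set2)

lemma gdist_le_diam: "u \<in> pverts G \<Longrightarrow> v \<in> pverts G \<Longrightarrow> gdist G u v \<le> diam G"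
  unfolding diam_def using finite_gdists by (blast intro: Max_ge)

lemma diam_le_trc:
  assumes "connected G"
  shows "2 * diam G \<le> trc G + 1"
proof -
  obtain c where c: "total_rainbow_connected G c" "num_colors G c = trc G"
    using trc_attained[OF assms] .
  have gdist_le: "2 * gdist G u v \<le> trc G + 1" if uv: "u \<in> pverts G" "v \<in> pverts G" for u v
  proof (cases "u = v")
    case True
    then show ?thesis using gdist_le_vwalk_length[OF vpath_self, of u] uv by simp
  next
    case False
    then obtain p where p: "vpath p G" "hd p = u" "last p = v" "total_rainbow c p"
      using c(1) uv unfolding total_rainbow_connected_def by blast
    then have "2 * vwalk_length p \<le> trc G + 1"
      using vwalk_length_le_num_colors[OF p(1,4)] c(2) by simp
    then show ?thesis using gdist_le_vwalk_length[OF p(1)] p(2,3) by simp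
  qed
  have "pverts G \<noteq> {}" using assms by (auto simp: connected_def strongly_connected_def)
  then have "diam G \<in> {gdist G u v | u v. u \<in> pverts G \<and> v \<in> pverts G}"
    unfolding diam_def by (intro Max_in finite_gdists) blast
  then show ?thesis using gdist_le by auto
qed

end

section \<open>Cycles\<close>

definition cyc_nth :: "'a list \<Rightarrow> nat \<Rightarrow> 'a" where
  "cyc_nth us k = us ! (k mod length us)"

lemma cyc_nth_mod [simp]: "cyc_nth us (k mod length us) = cyc_nth us k"
  by (simp add: cyc_nth_def)

lemma cyc_nth_add_length [simp]: "cyc_nth us (k + length us) = cyc_nth us k"
  by (simp add: cyc_nth_def)

lemma range_cyc_nth: "us \<noteq> [] \<Longrightarrow> range (cyc_nth us) = set us"
proof (intro equalityI subsetI)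
  fix u assume "u \<in> set us"
  then obtain k where "k < length us" "u = us ! k" by (metis in_set_conv_nth)
  then show "u \<in> range (cyc_nth us)" by (intro image_eqI[of _ _ k]) (simp_all add: cyc_nth_def)
qed (auto simp: cyc_nth_def)

lemma cyc_nth_in_set [simp]: "us \<noteq> [] \<Longrightarrow> cyc_nth us k \<in> set us"
  using range_cyc_nth by blast

lemma cyc_nth_eq_iff:
  "us \<noteq> [] \<Longrightarrow> distinct us \<Longrightarrow> cyc_nth us i = cyc_nth us j \<longleftrightarrow> i mod length us = j mod length us"
  by (simp add: cyc_nth_def nth_eq_iff_index_eq)

lemma mod_eq_imp_le_diff:
  fixes p q k :: nat
  assumes "p mod k = q mod k" "p < q"
  shows "k \<le> q - p"
proof -
  have "k dvd q - p" using assms by (metis less_imp_le mod_eq_dvd_iff_nat)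
  then show ?thesis using assms(2) by (simp add: dvd_imp_le)
qed

lemma cyc_nth_add_eq_iff:
  assumes "distinct us" "j < length us" "k < length us"
  shows "cyc_nth us (r + j) = cyc_nth us (r + k) \<longleftrightarrow> j = k"
proof -
  have ne: "us \<noteq> []" using assms(2) by auto
  show ?thesis
    using assms mod_eq_imp_le_diff[of "r + j" "length us" "r + k"]
      mod_eq_imp_le_diff[of "r + k" "length us" "r + j"]
    by (cases j k rule: linorder_cases) (auto simp: cyc_nth_eq_iff[OF ne])
qed

lemma cyc_nth_rotate: "us \<noteq> [] \<Longrightarrow> cyc_nth (rotate k us) i = cyc_nth us (k + i)"
  by (simp add: cyc_nth_def nth_rotate mod_add_right_eq)

lemma ex_offset:
  assumes "us \<noteq> []" "u \<in> set us"
  obtains m where "m < length us" "u = cyc_nth us (r + m)"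
proof -
  obtain j where "u = cyc_nth (rotate r us) j"
    using assms range_cyc_nth[of "rotate r us"] by auto
  then have "u = cyc_nth us (r + j mod length us)"
    using assms(1) cyc_nth_rotate[of us r] cyc_nth_mod[of "rotate r us"] by (metis length_rotate)
  then show ?thesis using that[of "j mod length us"] assms(1) by simp
qed

definition arc_between :: "'a list \<Rightarrow> nat \<Rightarrow> nat \<Rightarrow> 'a \<Rightarrow> 'a \<Rightarrow> bool" where
  "arc_between us r m u v \<longleftrightarrow>
     u = cyc_nth us r \<and> v = cyc_nth us (r + m) \<or> v = cyc_nth us r \<and> u = cyc_nth us (r + m)"

text \<open>Of the two arcs between opposite vertices, one does not pass the end of the list.\<close>

lemma ex_short_arc:
  assumes "u \<in> set us" "v \<in> set us"
  obtains r m where "arc_between us r m u v"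
    "2 * m < length us \<or> 2 * m = length us \<and> r + m < length us"
proof -
  note arc = that
  have thesis if ij: "i \<le> j" "j < length us"
    and uv: "u = us ! i \<and> v = us ! j \<or> v = us ! i \<and> u = us ! j" for i j
  proof (cases "2 * (j - i) \<le> length us")
    case True
    then show ?thesis
      using arc[of i "j - i"] ij uv by (auto simp: arc_between_def cyc_nth_def le_less)
  next
    case False
    then have "j + (length us - (j - i)) = i + length us" using ij by simp
    then show ?thesis
      using arc[of j "length us - (j - i)"] ij uv False by (auto simp: arc_between_def cyc_nth_def)
  qed
  then show ?thesis using assms by (metis in_set_conv_nth linear)
qed

lemma cycle_edges_eq_range:
  assumes "us \<noteq> []"
  shows "cycle_edges us = range (\<lambda>k. {cyc_nth us k, cyc_nth us (Suc k)})"
proof -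
  let ?l = "length us" and ?e = "\<lambda>k. {cyc_nth us k, cyc_nth us (Suc k)}"
  have "range ?e = ?e ` {..<?l}"
  proof (intro equalityI image_subsetI)
    fix k
    have "?e k = ?e (k mod ?l)" by (simp add: cyc_nth_def mod_Suc_eq)
    moreover have "k mod ?l \<in> {..<?l}" using assms by simp
    ultimately show "?e k \<in> ?e ` {..<?l}" by (rule image_eqI)
  qed auto
  also have "{..<?l} = insert (?l - 1) {0..<?l - 1}" using assms by (cases us) auto
  finally show ?thesis
    using assms
    by (auto simp: cycle_edges_def path_edges_eq_map cyc_nth_def last_conv_nth hd_conv_nth
        image_iff)
qed

lemma Union_cycle_edges: "us \<noteq> [] \<Longrightarrow> \<Union> (cycle_edges us) = set us"
  using range_cyc_nth[of us] by (auto simp: cycle_edges_eq_range)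

lemma cycle_edges_rotate:
  assumes "us \<noteq> []"
  shows "cycle_edges (rotate k us) = cycle_edges us"
proof -
  let ?e = "\<lambda>j. {cyc_nth us j, cyc_nth us (Suc j)}"
  have "?e j = ?e (k + (j + (length us - 1) * k))" for j
  proof -
    have "k + (j + (length us - 1) * k) = j + length us * k" using assms by (cases us) auto
    moreover have "?e (j + length us * k) = ?e j" by (simp add: cyc_nth_def flip: add_Suc)
    ultimately show ?thesis by (simp only:)
  qed
  then have "range ?e \<subseteq> range (\<lambda>j. ?e (k + j))" by (intro image_subsetI) (rule range_eqI)
  then have "range ?e = range (\<lambda>j. ?e (k + j))" by auto
  then show ?thesis using assms by (simp add: cycle_edges_eq_range cyc_nth_rotate)
qed

lemma inj_on_cycle_edge:
  assumes "3 \<le> length us" "distinct us"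
  shows "inj_on (\<lambda>k. {cyc_nth us k, cyc_nth us (Suc k)}) {..<length us}"
proof (rule inj_onI, rule ccontr)
  fix j k
  assume jk: "j \<in> {..<length us}" "k \<in> {..<length us}" "j \<noteq> k"
    and eq: "{cyc_nth us j, cyc_nth us (Suc j)} = {cyc_nth us k, cyc_nth us (Suc k)}"
  have ne: "us \<noteq> []" using assms(1) by auto
  have "cyc_nth us j \<noteq> cyc_nth us k" using jk assms(2) ne by (simp add: cyc_nth_eq_iff)
  then have "j = Suc k mod length us" "k = Suc j mod length us"
    using eq jk assms(2) ne by (auto simp: doubleton_eq_iff cyc_nth_eq_iff)
  then have "Suc (Suc j) mod length us = j" by (simp add: mod_Suc_eq)
  then show False
    using assms(1) jk(1)
    by (cases "Suc (Suc j) < length us") (auto simp: mod_if split: if_splits)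
qed

context pair_graph
begin

lemma ucycle_iff:
  "ucycle G us \<longleftrightarrow>
     3 \<le> length us \<and> distinct us \<and> set us \<subseteq> pverts G \<and> cycle_edges us \<subseteq> uedges G"
  using doubleton_in_uedges_iff[of "last us" "hd us"] vwalk_iff_uedges
  by (auto simp: ucycle_def vpath_def cycle_edges_def)

lemma ucycle_rotate:
  assumes "ucycle G us"
  shows "ucycle G (rotate k us)"
proof -
  have "us \<noteq> []" using assms by (auto simp: ucycle_def)
  then show ?thesis using assms by (simp add: ucycle_iff cycle_edges_rotate)
qed

lemma ucycle_if_vpath:
  assumes "vpath p G" "{hd p, last p} \<in> uedges G" "{hd p, last p} \<notin> set (path_edges p)"
  shows "ucycle G p"
proof -
  have arc: "(last p, hd p) \<in> parcs G"
    using assms(2) doubleton_in_uedges_iff arcs_symmetric by blast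
  have "p \<noteq> []" using assms(1) by auto
  moreover have "p \<noteq> [a]" for a using arc no_loops'[of a a] by auto
  moreover have "p \<noteq> [a, b]" for a b using assms(3) by (auto simp: path_edges_def edge_of_def)
  ultimately have "3 \<le> length p"
    by (cases p; cases "tl p"; cases "tl (tl p)") auto
  then show ?thesis using assms(1) arc by (simp add: ucycle_def)
qed

end

lemma unique_cycle_edges:
  assumes "connected_unicyclic G" "ucycle G us" "ucycle G vs"
  shows "cycle_edges us = cycle_edges vs"
  using assms unfolding connected_unicyclic_def by blast

lemma unique_cycle_length:
  assumes "connected_unicyclic G" "ucycle G us" "ucycle G vs"
  shows "length us = length vs"
proof -
  have "us \<noteq> []" "vs \<noteq> []" "distinct us" "distinct vs"
    using assms(2,3) by (auto simp: ucycle_def vpath_def)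
  moreover from this have "set us = set vs"
    using unique_cycle_edges[OF assms] Union_cycle_edges by metis
  ultimately show ?thesis using distinct_card by metis
qed

section \<open>Rooted forests on a cycle\<close>

locale rooted_cycle = pair_graph G
  for G :: "'a pair_pre_digraph" +
  fixes us :: "'a list" and parent :: "'a \<Rightarrow> 'a" and depth :: "'a \<Rightarrow> nat"
  assumes cyc: "ucycle G us"
    and parent_arc: "x \<in> pverts G - set us \<Longrightarrow> (x, parent x) \<in> parcs G"
    and depth_parent: "x \<in> pverts G - set us \<Longrightarrow> depth x = Suc (depth (parent x))"
    and depth_cycle: "x \<in> set us \<Longrightarrow> depth x = 0"
begin

abbreviation tree_verts :: "'a set" where "tree_verts \<equiv> pverts G - set us"

abbreviation up_edge :: "'a \<Rightarrow> 'a set" where "up_edge x \<equiv> {x, parent x}"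

definition stem :: "'a \<Rightarrow> 'a list" where
  "stem x = map (\<lambda>k. (parent ^^ k) x) [0..<Suc (depth x)]"

definition root :: "'a \<Rightarrow> 'a" where "root x = last (stem x)"

definition leaves :: "'a set" where "leaves = tree_verts - parent ` tree_verts"

definition cycle_walk :: "nat \<Rightarrow> nat \<Rightarrow> 'a list" where
  "cycle_walk r m = map (cyc_nth us) [r..<Suc (r + m)]"

definition route :: "'a \<Rightarrow> nat \<Rightarrow> nat \<Rightarrow> 'a \<Rightarrow> 'a list" where
  "route x r m y = stem x \<oplus> cycle_walk r m \<oplus> rev (stem y)"

lemma cycle_length: "3 \<le> length us"
  and cycle_not_Nil: "us \<noteq> []"
  and distinct_cycle: "distinct us"
  and cycle_in_verts: "set us \<subseteq> pverts G"
  and cycle_edges_in_uedges: "cycle_edges us \<subseteq> uedges G"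
  using cyc by (auto simp: ucycle_iff)

lemma cyc_nth_eq_iff_mod: "cyc_nth us i = cyc_nth us j \<longleftrightarrow> i mod length us = j mod length us"
  by (rule cyc_nth_eq_iff[OF cycle_not_Nil distinct_cycle])

lemma cyc_nth_add_eq_self_iff: "m < length us \<Longrightarrow> cyc_nth us (r + m) = cyc_nth us r \<longleftrightarrow> m = 0"
  using cyc_nth_add_eq_iff[OF distinct_cycle, of m 0 r] by fastforce

lemma parent_in_verts: "x \<in> tree_verts \<Longrightarrow> parent x \<in> pverts G"
  using parent_arc in_arcsD2 by blast

lemma up_edge_in_uedges: "x \<in> tree_verts \<Longrightarrow> up_edge x \<in> uedges G"
  using parent_arc doubleton_in_uedges_iff by blast

lemma up_edge_notin_cycle_edges: "x \<in> tree_verts \<Longrightarrow> up_edge x \<notin> cycle_edges us"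
  using Union_cycle_edges[OF cycle_not_Nil] by blast

lemma inj_on_up_edge: "inj_on up_edge tree_verts"
proof (rule inj_onI, rule ccontr)
  fix v w assume vw: "v \<in> tree_verts" "w \<in> tree_verts" "up_edge v = up_edge w" "v \<noteq> w"
  then have "v = parent w" "w = parent v" by (auto simp: doubleton_eq_iff)
  then show False using depth_parent[OF vw(1)] depth_parent[OF vw(2)] by simp
qed

lemma card_verts: "card (pverts G) = length us + card tree_verts"
  using cycle_in_verts card_Un_disjoint[of "set us" tree_verts] distinct_card[OF distinct_cycle]
  by (simp add: Un_absorb1)

lemma tree_induct [consumes 1, case_names cycle tree]:
  assumes "x \<in> pverts G"
    and "\<And>x. x \<in> set us \<Longrightarrow> P x"
    and "\<And>x. x \<in> tree_verts \<Longrightarrow> P (parent x) \<Longrightarrow> P x"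
  shows "P x"
  using assms(1)
proof (induction "depth x" arbitrary: x)
  case 0
  then show ?case using assms(2) depth_parent[of x] by auto
next
  case (Suc n)
  then have x: "x \<in> tree_verts" using depth_cycle[of x] by auto
  then show ?case using assms(3) Suc depth_parent[OF x] parent_in_verts[OF x] by auto
qed

lemma stem_cycle: "x \<in> set us \<Longrightarrow> stem x = [x]"
  by (simp add: stem_def depth_cycle)

lemma stem_tree:
  assumes "x \<in> tree_verts"
  shows "stem x = x # stem (parent x)"
proof -
  have "[0..<Suc (depth x)] = 0 # map Suc [0..<Suc (depth (parent x))]"
    unfolding depth_parent[OF assms]
    by (subst upt_conv_Cons) (simp_all add: map_Suc_upt del: upt_Suc)
  then show ?thesis by (simp add: stem_def comp_def funpow_swap1 del: upt_Suc)
qed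

lemma stem_not_Nil [simp]: "stem x \<noteq> []"
  by (simp add: stem_def)

lemma hd_stem [simp]: "hd (stem x) = x"
  by (simp add: stem_def hd_map del: upt_Suc)

lemma length_stem [simp]: "length (stem x) = Suc (depth x)"
  by (simp add: stem_def)

lemma self_in_stem [simp]: "x \<in> set (stem x)"
  using hd_in_set[OF stem_not_Nil] by simp

lemma last_stem [simp]: "last (stem x) = root x"
  by (simp add: root_def)

lemma root_in_stem [simp]: "root x \<in> set (stem x)"
  using last_in_set[OF stem_not_Nil] by simp

lemma root_cycle [simp]: "x \<in> set us \<Longrightarrow> root x = x"
  by (simp add: root_def stem_cycle del: last_stem)

lemma root_parent: "x \<in> tree_verts \<Longrightarrow> root (parent x) = root x"
  by (simp add: root_def stem_tree del: last_stem)

lemma root_in_cycle: "x \<in> pverts G \<Longrightarrow> root x \<in> set us"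
  by (induct x rule: tree_induct) (auto simp: root_parent)

lemma vwalk_stem: "x \<in> pverts G \<Longrightarrow> vwalk (stem x) G"
proof (induct x rule: tree_induct)
  case (cycle x)
  then show ?case using cycle_in_verts by (auto simp: stem_cycle)
next
  case (tree x)
  then show ?case using vwalk_consI[OF tree(2), of x] parent_arc by (simp add: stem_tree)
qed

lemma stem_in_verts: "x \<in> pverts G \<Longrightarrow> set (stem x) \<subseteq> pverts G"
  using vwalk_stem[of x] by (simp add: vwalk_def)

lemma root_eq_if_in_stem: "x \<in> pverts G \<Longrightarrow> v \<in> set (stem x) \<Longrightarrow> root v = root x"
  by (induct x rule: tree_induct) (auto simp: stem_cycle stem_tree root_parent)

lemma stem_Int_cycle:
  assumes "x \<in> pverts G"
  shows "set (stem x) \<inter> set us = {root x}"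
proof -
  have "v = root x" if "v \<in> set (stem x)" "v \<in> set us" for v
    using root_eq_if_in_stem[OF assms that(1)] that(2) by simp
  then show ?thesis using root_in_cycle[OF assms] by auto
qed

lemma path_edges_stem:
  "x \<in> pverts G \<Longrightarrow> set (path_edges (stem x)) = up_edge ` (set (stem x) - set us)"
proof (induct x rule: tree_induct)
  case (cycle x)
  then show ?case by (simp add: stem_cycle path_edges_def)
next
  case (tree x)
  then show ?case by (simp add: stem_tree path_edges_def edge_of_def insert_Diff_if)
qed

lemma depth_le_if_in_stem: "x \<in> pverts G \<Longrightarrow> v \<in> set (stem x) \<Longrightarrow> depth v \<le> depth x"
proof (induct x rule: tree_induct)
  case (tree x)
  then show ?case using depth_parent[OF tree(1)] by (auto simp: stem_tree)
qed (simp add: stem_cycle)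

lemma distinct_stem: "x \<in> pverts G \<Longrightarrow> distinct (stem x)"
proof (induct x rule: tree_induct)
  case (tree x)
  then have "x \<notin> set (stem (parent x))"
    using depth_le_if_in_stem[OF parent_in_verts] depth_parent by fastforce
  then show ?case using tree by (simp add: stem_tree)
qed (simp add: stem_cycle)

lemma card_stem:
  assumes "x \<in> pverts G"
  shows "card (set (stem x) - set us) = depth x"
proof -
  have "set (stem x) - set us = set (stem x) - {root x}" using stem_Int_cycle[OF assms] by blast
  then show ?thesis using distinct_card[OF distinct_stem[OF assms]] by simp
qed

lemma leaves_subset: "leaves \<subseteq> tree_verts"
  by (auto simp: leaves_def)

lemma finite_leaves: "finite leaves"
  using finite_subset[OF leaves_subset] by simp

lemma leaf_in_stem: "x \<in> pverts G \<Longrightarrow> a \<in> leaves \<Longrightarrow> a \<in> set (stem x) \<Longrightarrow> a = x"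
proof (induct x rule: tree_induct)
  case (tree x)
  then show ?case by (cases "a = x") (auto simp: stem_tree leaves_def)
qed (simp add: stem_cycle)

lemma ex_leaf_above:
  assumes "x \<in> tree_verts"
  shows "\<exists>a\<in>leaves. x \<in> set (stem a)"
proof -
  let ?A = "{y \<in> tree_verts. x \<in> set (stem y)}"
  have "finite ?A" "?A \<noteq> {}" using assms by auto
  then obtain y where y: "y \<in> ?A" "depth y = Max (depth ` ?A)"
    by (rule obtains_MAX[where f = depth]) auto
  have "y \<noteq> parent z" if "z \<in> tree_verts" for z
  proof
    assume "y = parent z"
    then have "z \<in> ?A" using y(1) that by (simp add: stem_tree[OF that])
    then have "depth z \<le> depth y" unfolding y(2) using \<open>finite ?A\<close> by (intro Max_ge) auto
    then show False using depth_parent[OF that] \<open>y = parent z\<close> by simp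
  qed
  then show ?thesis using y(1) by (auto simp: leaves_def)
qed

lemma root_leaves: "root ` leaves = root ` tree_verts"
proof (intro equalityI image_subsetI)
  fix x assume "x \<in> tree_verts"
  then obtain a where "a \<in> leaves" "x \<in> set (stem a)" using ex_leaf_above by blast
  moreover from this have "root x = root a" using root_eq_if_in_stem leaves_subset by blast
  ultimately show "root x \<in> root ` leaves" by simp
qed (use leaves_subset in blast)

lemma tree_verts_eq_stems: "tree_verts = (\<Union>a\<in>leaves. set (stem a) - set us)"
  using ex_leaf_above stem_in_verts leaves_subset by blast

lemma cycle_walk_not_Nil [simp]: "cycle_walk r m \<noteq> []"
  by (simp add: cycle_walk_def)

lemma hd_cycle_walk [simp]: "hd (cycle_walk r m) = cyc_nth us r"
  by (simp add: cycle_walk_def hd_map del: upt_Suc)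

lemma last_cycle_walk [simp]: "last (cycle_walk r m) = cyc_nth us (r + m)"
  by (simp add: cycle_walk_def)

lemma set_cycle_walk: "set (cycle_walk r m) = cyc_nth us ` {r..r + m}"
  by (simp add: cycle_walk_def atLeastLessThanSuc_atLeastAtMost del: upt_Suc)

lemma path_edges_cycle_walk:
  "set (path_edges (cycle_walk r m)) = (\<lambda>k. {cyc_nth us k, cyc_nth us (Suc k)}) ` {r..<r + m}"
proof -
  have "path_edges (cycle_walk r m)
      = map (\<lambda>i. {cyc_nth us (r + i), cyc_nth us (Suc (r + i))}) [0..<m]"
    by (simp add: path_edges_eq_map cycle_walk_def nth_append del: upt_Suc)
  also have "set \<dots> = (\<lambda>k. {cyc_nth us k, cyc_nth us (Suc k)}) ` (+) r ` {0..<m}"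
    by (simp only: set_map set_upt image_image)
  finally show ?thesis by (simp add: add.commute)
qed

lemma path_edges_cycle_walk_subset: "set (path_edges (cycle_walk r m)) \<subseteq> cycle_edges us"
  by (auto simp: path_edges_cycle_walk cycle_edges_eq_range[OF cycle_not_Nil])

context
  fixes x y r m
  assumes x: "x \<in> pverts G" "root x = cyc_nth us r"
    and y: "y \<in> pverts G" "root y = cyc_nth us (r + m)"
begin

lemma route_joinable:
  "joinable (stem x) (cycle_walk r m \<oplus> rev (stem y))" "joinable (cycle_walk r m) (rev (stem y))"
  using x y by (auto simp: vwalk_join_hd' hd_rev)

lemma hd_route: "hd (route x r m y) = x"
  by (simp add: route_def vwalk_join_hd')

lemma last_route: "last (route x r m y) = y"
  using route_joinable by (simp add: route_def vwalk_join_last last_rev)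

lemma path_edges_route:
  "set (path_edges (route x r m y)) = set (path_edges (cycle_walk r m)) \<union>
     up_edge ` (set (stem x) \<union> set (stem y) - set us)"
  using route_joinable path_edges_stem[OF x(1)] path_edges_stem[OF y(1)]
  by (auto simp: route_def set_path_edges_join set_path_edges_rev)

lemma set_route: "set (route x r m y) = set (stem x) \<union> cyc_nth us ` {r..r + m} \<union> set (stem y)"
proof -
  have "set (p \<oplus> q) = set p \<union> set q" if "joinable p q" for p q :: "'a list"
    using that by (cases q) (auto simp: vwalk_join_def joinable_def)
  then show ?thesis using route_joinable by (auto simp: route_def set_cycle_walk)
qed

lemma vwalk_route: "vwalk (route x r m y) G"
proof -
  have "set (path_edges (route x r m y)) \<subseteq> uedges G"
    unfolding path_edges_route
    using path_edges_cycle_walk_subset cycle_edges_in_uedges up_edge_in_uedges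
      stem_in_verts[OF x(1)] stem_in_verts[OF y(1)] by blast
  moreover have "set (route x r m y) \<subseteq> pverts G"
    unfolding set_route using stem_in_verts[OF x(1)] stem_in_verts[OF y(1)] cycle_in_verts
      range_cyc_nth[OF cycle_not_Nil] by blast
  moreover have "route x r m y \<noteq> []" by (simp add: route_def)
  ultimately show ?thesis by (simp add: vwalk_iff_uedges)
qed

end

lemma ex_root_position:
  assumes "x \<in> pverts G"
  obtains m where "m < length us" "root x = cyc_nth us (r + m)"
  using ex_offset[OF cycle_not_Nil root_in_cycle[OF assms]] .

end

locale unicyclic = rooted_cycle +
  assumes uedges_eq: "uedges G = cycle_edges us \<union> (\<lambda>x. {x, parent x}) ` (pverts G - set us)"
begin

lemma arc_cases:
  assumes "(v, w) \<in> parcs G"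
  obtains (cycle) "{v, w} \<in> cycle_edges us" | (up) "v \<in> tree_verts" "w = parent v"
    | (down) "w \<in> tree_verts" "v = parent w"
proof -
  have "{v, w} \<in> cycle_edges us \<union> up_edge ` tree_verts"
    using assms doubleton_in_uedges_iff uedges_eq by blast
  then show ?thesis using that by (auto simp: doubleton_eq_iff)
qed

lemma unicyclic_rotate: "unicyclic G (rotate k us) parent depth"
  by unfold_locales
    (use ucycle_rotate[OF cyc] parent_arc depth_parent depth_cycle uedges_eq
      cycle_edges_rotate[OF cycle_not_Nil] in simp_all)

end

lemma ex_parents_towards:
  fixes R :: "'a rel"
  assumes "R \<subseteq> V \<times> V" "\<And>x. x \<in> V \<Longrightarrow> \<exists>u\<in>S. (x, u) \<in> R\<^sup>*"
  obtains parent :: "'a \<Rightarrow> 'a" and depth :: "'a \<Rightarrow> nat" where "\<And>x. x \<in> S \<Longrightarrow> depth x = 0"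
    "\<And>x. x \<in> V - S \<Longrightarrow> (x, parent x) \<in> R \<and> depth x = Suc (depth (parent x))"
proof -
  define depth where "depth x = (LEAST k. \<exists>u\<in>S. (x, u) \<in> R ^^ k)" for x
  have depth_le: "depth x \<le> k" if "u \<in> S" "(x, u) \<in> R ^^ k" for x u k
    unfolding depth_def using that by (blast intro: Least_le)
  have reaches: "\<exists>u\<in>S. (x, u) \<in> R ^^ depth x" if "x \<in> V" for x
  proof -
    have "\<exists>k. \<exists>u\<in>S. (x, u) \<in> R ^^ k" using assms(2)[OF that] by (blast dest: rtrancl_imp_relpow)
    then show ?thesis unfolding depth_def by (rule LeastI_ex)
  qed
  have "\<exists>y. (x, y) \<in> R \<and> depth x = Suc (depth y)" if x: "x \<in> V - S" for x
  proof -
    obtain u where u: "u \<in> S" "(x, u) \<in> R ^^ depth x" using reaches x by blast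
    then obtain k where k: "depth x = Suc k" using x by (cases "depth x") auto
    then obtain y where y: "(x, y) \<in> R" "(y, u) \<in> R ^^ k" using u(2) by (metis relpow_Suc_D2)
    obtain w where w: "w \<in> S" "(y, w) \<in> R ^^ depth y" using reaches y(1) assms(1) by blast
    have "depth x \<le> Suc (depth y)"
      using depth_le[OF w(1)] relpow_Suc_I2[OF y(1) w(2)] by blast
    moreover have "depth y \<le> k" using depth_le[OF u(1) y(2)] .
    ultimately show ?thesis using k y(1) by auto
  qed
  then obtain parent where "\<And>x. x \<in> V - S \<Longrightarrow> (x, parent x) \<in> R \<and> depth x = Suc (depth (parent x))"
    by metis
  moreover have "depth x = 0" if "x \<in> S" for x using depth_le[OF that, of x 0] by simp
  ultimately show ?thesis using that by blast
qed

lemma (in pair_graph) ex_rooted_cycle: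
  assumes "connected G" "ucycle G us"
  obtains parent depth where "rooted_cycle G us parent depth"
proof -
  have us: "us \<noteq> []" "set us \<subseteq> pverts G"
    using assms(2) by (auto simp: ucycle_iff)
  have "\<exists>u\<in>set us. (x, u) \<in> (parcs G)\<^sup>*" if x: "x \<in> pverts G" for x
  proof -
    have hd: "hd us \<in> set us" using us(1) by simp
    then have "x \<rightarrow>\<^sup>*\<^bsub>with_proj G\<^esub> hd us" using connected_imp_reachable[OF assms(1) x] us(2) by blast
    then have "(x, hd us) \<in> (parcs G)\<^sup>*"
      by (metis reachable_def rtrancl_on_rtranclI with_proj_simps(3))
    then show ?thesis using hd by blast
  qed
  moreover have "parcs G \<subseteq> pverts G \<times> pverts G" using wellformed' by auto
  ultimately obtain parent depth where "\<And>x. x \<in> set us \<Longrightarrow> depth x = 0"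
    "\<And>x. x \<in> pverts G - set us \<Longrightarrow> (x, parent x) \<in> parcs G \<and> depth x = Suc (depth (parent x))"
    using ex_parents_towards[of "parcs G" "pverts G" "set us"] by metis
  then have "rooted_cycle G us parent depth" using assms(2) by unfold_locales auto
  then show ?thesis using that by blast
qed

text \<open>
  An edge outside the cycle and the parent edges would close a second cycle with the route between
  its ends.
\<close>

lemma (in rooted_cycle) unicyclic_if_connected_unicyclic:
  assumes "connected_unicyclic G"
  shows "unicyclic G us parent depth"
proof unfold_locales
  let ?E = "cycle_edges us \<union> up_edge ` tree_verts"
  have "e \<in> ?E" if e: "e \<in> uedges G" for e
  proof (rule ccontr)
    assume "e \<notin> ?E"
    obtain x y where xy: "e = {x, y}" "(x, y) \<in> parcs G"
      using e by (auto simp: uedges_def edge_of_def)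
    then have V: "x \<in> pverts G" "y \<in> pverts G" using wellformed' by auto
    obtain r where r: "root x = cyc_nth us r" using ex_root_position[OF V(1), of 0] by auto
    obtain m where m: "root y = cyc_nth us (r + m)" using ex_root_position[OF V(2)] .
    have "set (path_edges (route x r m y)) \<subseteq> ?E"
      using path_edges_route[OF V(1) r V(2) m] path_edges_cycle_walk_subset
        stem_in_verts[OF V(1)] stem_in_verts[OF V(2)] by blast
    then obtain p where p: "vpath p G" "hd p = x" "last p = y" "set (path_edges p) \<subseteq> ?E"
      using vwalk_contains_vpath[OF vwalk_route[OF V(1) r V(2) m]]
        hd_route[OF V(1) r V(2) m] last_route[OF V(1) r V(2) m] by (metis subset_trans)
    then have "ucycle G p"
      using ucycle_if_vpath[OF p(1)] xy(1) e \<open>e \<notin> ?E\<close> by blast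
    then have "cycle_edges p = cycle_edges us" using unique_cycle_edges[OF assms _ cyc] by blast
    moreover have "e \<in> cycle_edges p" using xy(1) p(2,3) by (auto simp: cycle_edges_def)
    ultimately show False using \<open>e \<notin> ?E\<close> by blast
  qed
  then show "uedges G = ?E" using cycle_edges_in_uedges up_edge_in_uedges by blast
qed

lemma connected_unicyclic_imp_unicyclic:
  assumes "connected_unicyclic G" "ucycle G us"
  obtains parent depth where "unicyclic G us parent depth"
  using assms pair_graph.ex_rooted_cycle[of G us] rooted_cycle.unicyclic_if_connected_unicyclic
  unfolding connected_unicyclic_def by metis

section \<open>Total-colorings from a word around the cycle\<close>

text \<open>Position \<open>2 k\<close> is the \<open>k\<close>-th vertex of the cycle and position \<open>2 k + 1\<close> the edge after it.\<close>

definition cycle_element :: "'a list \<Rightarrow> nat \<Rightarrow> 'a + 'a set" where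
  "cycle_element us p = (if even p then Inl (cyc_nth us (p div 2))
     else Inr {cyc_nth us (p div 2), cyc_nth us (Suc (p div 2))})"

lemma cycle_element_even [simp]: "cycle_element us (2 * k) = Inl (cyc_nth us k)"
  by (simp add: cycle_element_def)

lemma cycle_element_odd [simp]:
  "cycle_element us (Suc (2 * k)) = Inr {cyc_nth us k, cyc_nth us (Suc k)}"
  by (simp add: cycle_element_def)

lemma cycle_element_mod: "cycle_element us (p mod (2 * length us)) = cycle_element us p"
proof -
  have "p mod (2 * length us) div 2 = p div 2 mod length us"
    using mod_mult2_eq[of p 2 "length us"] by (simp add: div_mult2_eq)
  moreover have "even (p mod (2 * length us)) \<longleftrightarrow> even p"
    by (metis dvd_mod_iff dvd_triv_left)
  ultimately show ?thesis by (simp add: cycle_element_def cyc_nth_def mod_Suc_eq)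
qed

lemma inj_on_cycle_element:
  assumes "3 \<le> length us" "distinct us"
  shows "inj_on (cycle_element us) {..<2 * length us}"
proof (rule inj_onI)
  fix p q
  assume pq: "p \<in> {..<2 * length us}" "q \<in> {..<2 * length us}"
    and eq: "cycle_element us p = cycle_element us q"
  have lt: "p div 2 < length us" "q div 2 < length us" using pq by auto
  have parity: "even p \<longleftrightarrow> even q" using eq by (auto simp: cycle_element_def split: if_splits)
  have "p div 2 = q div 2"
  proof (cases "even p")
    case True
    then have "cyc_nth us (p div 2) = cyc_nth us (q div 2)"
      using eq parity by (simp add: cycle_element_def)
    then show ?thesis using lt assms(2) by (simp add: cyc_nth_def nth_eq_iff_index_eq)
  next
    case False
    then show ?thesis
      using eq parity lt inj_onD[OF inj_on_cycle_edge[OF assms], of "p div 2" "q div 2"]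
      by (simp add: cycle_element_def)
  qed
  then show "p = q" using parity by (metis dvd_mult_div_cancel odd_two_times_div_two_succ)
qed

text \<open>
  The positions of the arc of \<open>m\<close> edges from vertex \<open>r\<close>. An end carrying no tree (its residue modulo
  \<open>l\<close> is not in \<open>N\<close>) is omitted, because there the path starts on the cycle itself.
\<close>

definition arc_positions :: "nat \<Rightarrow> nat set \<Rightarrow> nat \<Rightarrow> nat \<Rightarrow> nat list" where
  "arc_positions l N r m =
     [2 * r + (if r mod l \<in> N then 0 else 1)..<2 * (r + m) + (if (r + m) mod l \<in> N then 1 else 0)]"

definition rainbow_arc :: "(nat \<Rightarrow> 'c) \<Rightarrow> nat \<Rightarrow> nat set \<Rightarrow> nat \<Rightarrow> nat \<Rightarrow> 'c set \<Rightarrow> bool" where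
  "rainbow_arc w l N r m F \<longleftrightarrow>
     (let cs = map (\<lambda>p. w (p mod (2 * l))) (arc_positions l N r m)
      in distinct cs \<and> (\<forall>c\<in>set cs. c \<notin> F))"

lemma rainbow_arc_comp:
  assumes "rainbow_arc w l N r m F" "inj_on g C" "\<And>p. w (p mod (2 * l)) \<in> C"
    and "\<And>c. c \<in> C \<Longrightarrow> g c \<in> F' \<Longrightarrow> c \<in> F"
  shows "rainbow_arc (g \<circ> w) l N r m F'"
proof -
  let ?cs = "map (\<lambda>p. w (p mod (2 * l))) (arc_positions l N r m)"
  have "set ?cs \<subseteq> C" using assms(3) by auto
  then have "inj_on g (set ?cs)" using assms(2) by (rule inj_on_subset[rotated])
  then have "distinct (map g ?cs)"
    using assms(1) distinct_map[of g ?cs] by (simp add: rainbow_arc_def Let_def)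
  moreover have "\<forall>c\<in>set (map g ?cs). c \<notin> F'"
    using assms(1,3,4) by (auto simp: rainbow_arc_def Let_def)
  ultimately show ?thesis by (simp add: rainbow_arc_def Let_def comp_def)
qed

datatype 'a color = Fresh nat | Own "'a + 'a set"

definition (in rooted_cycle) pendant :: "'a \<Rightarrow> 'a color" where
  "pendant a = Own (Inr (up_edge a))"

lemma (in rooted_cycle) inj_on_pendant: "inj_on pendant tree_verts"
  using inj_on_up_edge by (auto simp: inj_on_def pendant_def)

text \<open>
  A word of \<open>2 l\<close> letters colors the cycle with \<open>K\<close> fresh colors and colors of pendant edges. A
  path may meet the color of a pendant edge on the cycle unless it ends in the leaf concerned,
  since leaves are never internal.
\<close>

locale cycle_word = unicyclic G us parent depth
  for G :: "'a pair_pre_digraph" and us parent depth +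
  fixes K :: nat and w :: "nat \<Rightarrow> 'a color" and N :: "nat set"
  assumes vertex_letter: "k < length us \<Longrightarrow> w (2 * k) \<in> Fresh ` {..<K}"
    and letter: "p < 2 * length us \<Longrightarrow> w p \<in> Fresh ` {..<K} \<union> pendant ` leaves"
    and tree_position: "x \<in> tree_verts \<Longrightarrow> root x = cyc_nth us k \<Longrightarrow> k mod length us \<in> N"
begin

definition coloring :: "'a + 'a set \<Rightarrow> 'a color" where
  "coloring z =
     (if z \<in> range (cycle_element us) then w (the_inv_into {..<2 * length us} (cycle_element us) z)
      else if z \<in> Inl ` leaves then Fresh 0 else Own z)"

lemma letter_mod: "w (p mod (2 * length us)) \<in> Fresh ` {..<K} \<union> pendant ` leaves"
  using letter cycle_not_Nil by simp

lemma coloring_cycle_element: "coloring (cycle_element us p) = w (p mod (2 * length us))"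
proof -
  let ?p = "p mod (2 * length us)"
  have "?p \<in> {..<2 * length us}" using cycle_not_Nil by simp
  then have "the_inv_into {..<2 * length us} (cycle_element us) (cycle_element us ?p) = ?p"
    using the_inv_into_f_f[OF inj_on_cycle_element[OF cycle_length distinct_cycle]] by blast
  then show ?thesis by (simp add: coloring_def cycle_element_mod)
qed

lemma range_cycle_element: "range (cycle_element us) = set us <+> cycle_edges us"
proof -
  have "Inl u \<in> range (cycle_element us)" if "u \<in> range (cyc_nth us)" for u
    using that by (auto simp flip: cycle_element_even)
  moreover have "Inr e \<in> range (cycle_element us)"
    if "e \<in> range (\<lambda>k. {cyc_nth us k, cyc_nth us (Suc k)})" for e
    using that by (auto simp flip: cycle_element_odd)
  moreover have "range (cycle_element us)
      \<subseteq> range (cyc_nth us) <+> range (\<lambda>k. {cyc_nth us k, cyc_nth us (Suc k)})"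
    by (auto simp: cycle_element_def)
  ultimately show ?thesis
    unfolding cycle_edges_eq_range[OF cycle_not_Nil] range_cyc_nth[OF cycle_not_Nil, symmetric]
    by blast
qed

lemma coloring_leaf: "a \<in> leaves \<Longrightarrow> coloring (Inl a) = Fresh 0"
  using leaves_subset by (auto simp: coloring_def range_cycle_element)

lemma coloring_tree_element:
  assumes "z \<in> (tree_verts - leaves) <+> up_edge ` tree_verts"
  shows "coloring z = Own z"
  using assms up_edge_notin_cycle_edges by (auto simp: coloring_def range_cycle_element)

lemma card_coloring:
  "card (coloring ` (pverts G <+> uedges G)) + card leaves \<le> K + 2 * card tree_verts"
proof -
  let ?Q = "(tree_verts - leaves) <+> up_edge ` tree_verts"
  have "0 < K" using vertex_letter[of 0] cycle_not_Nil by auto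
  have "coloring z \<in> Fresh ` {..<K} \<union> Own ` ?Q" if z: "z \<in> pverts G <+> uedges G" for z
  proof -
    consider p where "z = cycle_element us p" | a where "z = Inl a" "a \<in> leaves" | "z \<in> ?Q"
      using z uedges_eq range_cycle_element by (elim PlusE) blast+
    then show ?thesis
    proof cases
      case 1
      have "pendant ` leaves \<subseteq> Own ` ?Q" using leaves_subset by (auto simp: pendant_def)
      then show ?thesis using 1 letter_mod[of p] by (auto simp: coloring_cycle_element)
    next
      case 2
      then show ?thesis using coloring_leaf \<open>0 < K\<close> by auto
    next
      case 3
      then show ?thesis using coloring_tree_element by blast
    qed
  qed
  then have "card (coloring ` (pverts G <+> uedges G)) \<le> card (Fresh ` {..<K} \<union> Own ` ?Q)"
    by (intro card_mono) auto
  also have "\<dots> \<le> card (Fresh ` {..<K} :: 'a color set) + card (Own ` ?Q)" by (rule card_Un_le)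
  also have "\<dots> \<le> K + card ?Q"
    using card_image_le[of "{..<K}" "Fresh :: nat \<Rightarrow> 'a color"] card_image_le[of ?Q Own] by simp
  also have "card ?Q = card (tree_verts - leaves) + card tree_verts"
    by (simp add: card_Plus card_image[OF inj_on_up_edge])
  finally show ?thesis
    using card_Diff_subset[OF finite_leaves leaves_subset] card_mono[OF _ leaves_subset] by simp
qed

context
  fixes x y r m
  assumes x: "x \<in> pverts G" "root x = cyc_nth us r"
    and y: "y \<in> pverts G" "root y = cyc_nth us (r + m)"
begin

lemma inner_elements_route:
  "inner_elements (route x r m y) \<subseteq> cycle_element us ` set (arc_positions (length us) N r m) \<union>
     ((set (stem x) \<union> set (stem y) - set us - {x, y}) <+>
       up_edge ` (set (stem x) \<union> set (stem y) - set us))"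
proof -
  let ?P = "cycle_element us ` set (arc_positions (length us) N r m)"
  let ?A = "set (stem x) \<union> set (stem y) - set us"
  have cycle_vertex: "Inl (cyc_nth us k) \<in> ?P"
    if k: "r \<le> k" "k \<le> r + m" "cyc_nth us k \<noteq> x" "cyc_nth us k \<noteq> y" for k
  proof -
    have "x \<in> tree_verts" if "k = r" using x k(3) that root_cycle[of x] by auto
    then have "k = r \<longrightarrow> r mod length us \<in> N" using tree_position x(2) by blast
    moreover have "y \<in> tree_verts" if "k = r + m" using y k(4) that root_cycle[of y] by auto
    then have "k = r + m \<longrightarrow> (r + m) mod length us \<in> N" using tree_position y(2) by blast
    ultimately have "2 * k \<in> set (arc_positions (length us) N r m)"
      using k(1,2) by (auto simp: arc_positions_def)
    then show ?thesis by (metis cycle_element_even imageI)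
  qed
  have vertices: "Inl v \<in> ?P \<union> Inl ` (?A - {x, y})"
    if v: "v \<in> set (route x r m y)" "v \<noteq> x" "v \<noteq> y" for v
  proof (cases "v \<in> set us")
    case True
    then obtain k where "v = cyc_nth us k" "r \<le> k" "k \<le> r + m"
      using v(1) stem_Int_cycle[OF x(1)] stem_Int_cycle[OF y(1)] x(2) y(2)
      unfolding set_route[OF x y] by fastforce
    then show ?thesis using cycle_vertex v(2,3) by blast
  next
    case False
    then have "v \<in> ?A" using v(1) cycle_not_Nil unfolding set_route[OF x y] by auto
    then show ?thesis using v(2,3) by blast
  qed
  have edges: "Inr e \<in> ?P" if "e \<in> set (path_edges (cycle_walk r m))" for e
  proof -
    obtain k where k: "e = {cyc_nth us k, cyc_nth us (Suc k)}" "r \<le> k" "k < r + m"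
      using \<open>e \<in> _\<close> by (auto simp: path_edges_cycle_walk)
    then have "Suc (2 * k) \<in> set (arc_positions (length us) N r m)"
      by (auto simp: arc_positions_def)
    then show ?thesis using k(1) by (metis cycle_element_odd imageI)
  qed
  show ?thesis
    unfolding inner_elements_def hd_route[OF x y] last_route[OF x y] path_edges_route[OF x y]
    using vertices edges by blast
qed

lemma inj_on_coloring_route:
  assumes "rainbow_arc w (length us) N r m (pendant ` (leaves \<inter> {x, y}))"
  shows "inj_on coloring (inner_elements (route x r m y))"
proof -
  let ?I = "set (arc_positions (length us) N r m)" and ?A = "set (stem x) \<union> set (stem y) - set us"
  let ?P = "cycle_element us ` ?I" and ?Q = "(?A - {x, y}) <+> up_edge ` ?A"
  have A: "?A \<subseteq> tree_verts" using stem_in_verts[OF x(1)] stem_in_verts[OF y(1)] by blast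
  have leaf_end: "a \<in> {x, y}" if "a \<in> leaves" "a \<in> ?A" for a
    using leaf_in_stem[OF x(1)] leaf_in_stem[OF y(1)] that by blast
  then have "?Q \<subseteq> (tree_verts - leaves) <+> up_edge ` tree_verts" using A by blast
  then have own: "coloring z = Own z" if "z \<in> ?Q" for z using coloring_tree_element that by blast
  have "inj_on (\<lambda>p. w (p mod (2 * length us))) ?I"
    using assms by (simp add: rainbow_arc_def Let_def distinct_map)
  then have "inj_on (coloring \<circ> cycle_element us) ?I"
    by (simp add: comp_def coloring_cycle_element)
  then have "inj_on coloring ?P" by (rule inj_on_imageI)
  moreover have "inj_on coloring ?Q" by (rule inj_onI) (simp add: own)
  moreover have "coloring u \<noteq> coloring v" if u: "u \<in> ?P" and v: "v \<in> ?Q" for u v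
  proof
    assume eq: "coloring u = coloring v"
    obtain p where p: "p \<in> ?I" "coloring u = w (p mod (2 * length us))"
      using u coloring_cycle_element by auto
    then have "w (p mod (2 * length us)) = Own v" using eq own[OF v] by simp
    then obtain a
      where a: "a \<in> leaves" "w (p mod (2 * length us)) = pendant a" "v = Inr (up_edge a)"
      using letter_mod[of p] by (auto simp: pendant_def)
    then obtain b where "b \<in> ?A" "up_edge a = up_edge b" using v by blast
    then have "a \<in> ?A" using inj_onD[OF inj_on_up_edge, of a b] a(1) A leaves_subset by blast
    then have "pendant a \<in> pendant ` (leaves \<inter> {x, y})" using leaf_end[OF a(1)] a(1) by blast
    then show False using assms p(1) a(2) by (auto simp: rainbow_arc_def Let_def)
  qed
  ultimately have "inj_on coloring (?P \<union> ?Q)" unfolding inj_on_Un by blast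
  then show ?thesis using inner_elements_route inj_on_subset by blast
qed

lemma rainbow_joined_if_rainbow_arc:
  assumes "rainbow_arc w (length us) N r m (pendant ` (leaves \<inter> {x, y}))"
  shows "rainbow_joined coloring x y"
  unfolding rainbow_joined_def
  using vwalk_route[OF x y] hd_route[OF x y] last_route[OF x y] inj_on_coloring_route[OF assms]
  by blast

end

lemma trc_le_if_rainbow_arcs:
  assumes "\<And>x y. x \<in> pverts G \<Longrightarrow> y \<in> pverts G \<Longrightarrow> \<exists>r m.
      arc_between us r m (root x) (root y) \<and>
      rainbow_arc w (length us) N r m (pendant ` (leaves \<inter> {x, y}))"
  shows "trc G + card leaves + 2 * length us \<le> 2 * card (pverts G) + K"
proof -
  have "rainbow_joined coloring x y" if xy: "x \<in> pverts G" "y \<in> pverts G" for x y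
  proof -
    obtain r m where "arc_between us r m (root x) (root y)"
      and rainbow: "rainbow_arc w (length us) N r m (pendant ` (leaves \<inter> {x, y}))"
      using assms[OF xy] by blast
    then show ?thesis
      unfolding arc_between_def
    proof (elim disjE)
      assume "root x = cyc_nth us r \<and> root y = cyc_nth us (r + m)"
      then show ?thesis using rainbow_joined_if_rainbow_arc[OF xy(1) _ xy(2) _ rainbow] by simp
    next
      assume "root y = cyc_nth us r \<and> root x = cyc_nth us (r + m)"
      then have "rainbow_joined coloring y x"
        using rainbow_joined_if_rainbow_arc[OF xy(2) _ xy(1)] rainbow by (simp add: insert_commute)
      then show ?thesis by (rule rainbow_joined_sym)
    qed
  qed
  then have "trc G \<le> card (coloring ` (pverts G <+> uedges G))"
    by (rule trc_le_card_colors)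
  then show ?thesis using card_coloring card_verts by linarith
qed

end

section \<open>Periodic words\<close>

lemma rainbow_arcI:
  assumes "\<And>p q. 2 * r + (if r mod l \<in> N then 0 else 1) \<le> p \<Longrightarrow> p < q \<Longrightarrow>
      q < 2 * (r + m) + (if (r + m) mod l \<in> N then 1 else 0) \<Longrightarrow>
      w (p mod (2 * l)) \<noteq> w (q mod (2 * l))"
  shows "rainbow_arc w l N r m {}"
  using assms
  by (auto simp: rainbow_arc_def arc_positions_def Let_def distinct_map intro!: linorder_inj_onI'
      split del: if_split)

lemma rainbow_arc_mod_length:
  assumes "2 * m < l \<or> 2 * m = l \<and> (r mod l \<notin> N \<or> (r + m) mod l \<notin> N)"
  shows "rainbow_arc (\<lambda>p. p mod l) l N r m {}"
proof (rule rainbow_arcI, rule notI)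
  fix p q
  assume "2 * r + (if r mod l \<in> N then 0 else 1) \<le> p" "p < q"
    "q < 2 * (r + m) + (if (r + m) mod l \<in> N then 1 else 0)"
    and "p mod (2 * l) mod l = q mod (2 * l) mod l"
  moreover from this have "l \<le> q - p" by (intro mod_eq_imp_le_diff) (simp_all add: mod_mod_cancel)
  ultimately show False using assms by (auto split: if_splits)
qed

text \<open>
  Equal letters are \<open>l + 1\<close> positions apart, or \<open>l - 1\<close> when counted across the end of the word.
\<close>

lemma rainbow_arc_mod_Suc_length:
  assumes "2 * m + 2 \<le> l \<or> 2 * m \<le> l \<and> r + m < l"
  shows "rainbow_arc (\<lambda>p. p mod (l + 1)) l N r m {}"
proof (rule rainbow_arcI, rule notI)
  fix p q
  assume "2 * r + (if r mod l \<in> N then 0 else 1) \<le> p" "p < q"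
    "q < 2 * (r + m) + (if (r + m) mod l \<in> N then 1 else 0)"
    and eq: "p mod (2 * l) mod (l + 1) = q mod (2 * l) mod (l + 1)"
  then have pq: "2 * r \<le> p" "p < q" "q \<le> 2 * (r + m)" by (auto split: if_splits)
  let ?p = "p mod (2 * l)" and ?q = "q mod (2 * l)"
  have "?q = (?p + (q - p)) mod (2 * l)" using mod_add_left_eq[of p "2 * l" "q - p"] pq(2) by simp
  moreover have "?p < 2 * l" "q - p < 2 * l" using assms pq by auto
  ultimately consider "?q = ?p + (q - p)" | "?p = ?q + (2 * l - (q - p))"
    by (cases "?p + (q - p) < 2 * l") (simp_all add: le_mod_geq)
  then show False
  proof cases
    case 1
    then have "l + 1 \<le> q - p" using mod_eq_imp_le_diff[OF eq] pq(2) by simp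
    then show False using assms pq by auto
  next
    case 2
    then have "q \<ge> 2 * l" using pq(2) \<open>q - p < 2 * l\<close> by (auto intro: ccontr)
    then have m: "2 * m + 2 \<le> l" using assms pq(3) by auto
    have "l + 1 dvd 2 * l - (q - p)"
      using eq 2 by (metis diff_add_inverse le_add1 mod_eq_dvd_iff_nat)
    then have "l + 1 dvd 2 * l - (q - p) - (l + 1)" by (rule dvd_diff_nat) simp
    moreover have "0 < 2 * l - (q - p) - (l + 1)" "2 * l - (q - p) - (l + 1) < l + 1"
      using m pq by auto
    ultimately show False using nat_dvd_not_less by blast
  qed
qed

context unicyclic
begin

definition tree_positions :: "nat set" where
  "tree_positions = {k. cyc_nth us k \<in> root ` tree_verts}"

lemma trc_le_if_short_arcs_rainbow:
  assumes "\<And>p. w p < K"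
    and "\<And>r m. 2 * m < length us \<or> 2 * m = length us \<and> r + m < length us \<Longrightarrow>
      rainbow_arc w (length us) tree_positions r m {}"
  shows "trc G + card leaves + 2 * length us \<le> 2 * card (pverts G) + K"
proof -
  interpret cycle_word G us parent depth K "Fresh \<circ> w" tree_positions
  proof
    fix x k assume "x \<in> tree_verts" "root x = cyc_nth us k"
    then have "cyc_nth us k \<in> root ` tree_verts" by (metis imageI)
    then show "k mod length us \<in> tree_positions" by (simp add: tree_positions_def)
  qed (use assms(1) in auto)
  show ?thesis
  proof (rule trc_le_if_rainbow_arcs)
    fix x y assume "x \<in> pverts G" "y \<in> pverts G"
    then obtain r m where arc: "arc_between us r m (root x) (root y)"
      and short: "2 * m < length us \<or> 2 * m = length us \<and> r + m < length us"
      using ex_short_arc[OF root_in_cycle root_in_cycle] by metis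
    have "rainbow_arc (Fresh \<circ> w) (length us) tree_positions r m (pendant ` (leaves \<inter> {x, y}))"
      by (rule rainbow_arc_comp[OF assms(2)[OF short], of _ UNIV])
        (auto simp: inj_on_def pendant_def)
    then show "\<exists>r m. arc_between us r m (root x) (root y) \<and>
        rainbow_arc (Fresh \<circ> w) (length us) tree_positions r m (pendant ` (leaves \<inter> {x, y}))"
      using arc by blast
  qed
qed

lemma trc_le_if_no_opposite_trees:
  assumes "\<And>r m. 2 * m = length us \<Longrightarrow> cyc_nth us r \<in> root ` leaves \<Longrightarrow>
      cyc_nth us (r + m) \<notin> root ` leaves"
  shows "trc G + card leaves + length us \<le> 2 * card (pverts G)"
proof -
  have "trc G + card leaves + 2 * length us \<le> 2 * card (pverts G) + length us"
  proof (rule trc_le_if_short_arcs_rainbow)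
    show "p mod length us < length us" for p using cycle_not_Nil by simp
    show "rainbow_arc (\<lambda>p. p mod length us) (length us) tree_positions r m {}"
      if "2 * m < length us \<or> 2 * m = length us \<and> r + m < length us" for r m
      using that assms[of m r]
      by (intro rainbow_arc_mod_length) (auto simp: tree_positions_def root_leaves)
  qed
  then show ?thesis by simp
qed

lemma trc_le_if_single_leaf:
  assumes "leaves = {a}"
  shows "trc G + 1 + length us \<le> 2 * card (pverts G)"
proof -
  have ne: "cyc_nth us (r + m) \<noteq> cyc_nth us r" if "2 * m = length us" for r m
  proof -
    have "0 < m" "m < length us" using that cycle_length by linarith+
    then show ?thesis using cyc_nth_add_eq_self_iff by simp
  qed
  have "trc G + card leaves + length us \<le> 2 * card (pverts G)"
    by (rule trc_le_if_no_opposite_trees) (metis assms image_empty image_insert ne singletonD)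
  then show ?thesis using assms by simp
qed

lemma trc_le_if_even_cycle:
  assumes "even (length us)"
  shows "trc G + card leaves + length us \<le> 2 * card (pverts G) + 1"
proof -
  have "trc G + card leaves + 2 * length us \<le> 2 * card (pverts G) + (length us + 1)"
  proof (rule trc_le_if_short_arcs_rainbow)
    show "p mod (length us + 1) < length us + 1" for p by simp
    show "rainbow_arc (\<lambda>p. p mod (length us + 1)) (length us) tree_positions r m {}"
      if "2 * m < length us \<or> 2 * m = length us \<and> r + m < length us" for r m
      using that assms by (intro rainbow_arc_mod_Suc_length) (auto elim!: evenE)
  qed
  then show ?thesis by simp
qed

end

section \<open>Words reusing the colors of pendant edges\<close>

text \<open>
  In a word \<open>xs\<close> of numbers those below \<open>K\<close> are fresh colors, and \<open>K + k\<close> is the color of the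
  pendant edge of the \<open>k\<close>-th selected leaf, whose tree is at position \<open>ps ! k\<close>. The number
  \<open>K + length ps\<close>, which is not a letter, stands for any other end of a path. All trees are at
  positions in \<open>N\<close>.
\<close>

definition end_codes :: "nat \<Rightarrow> nat list \<Rightarrow> nat \<Rightarrow> nat list" where
  "end_codes K ps i = (K + length ps) # map ((+) K) (filter (\<lambda>k. ps ! k = i) [0..<length ps])"

definition scheme :: "nat \<Rightarrow> nat \<Rightarrow> nat list \<Rightarrow> nat list \<Rightarrow> nat list \<Rightarrow> bool" where
  "scheme l K N ps xs \<longleftrightarrow>
     (\<forall>i\<in>set (N @ ps). i < l) \<and>
     (\<forall>p\<in>set [0..<2 * l]. xs ! p < K + length ps) \<and>
     (\<forall>k\<in>set [0..<l]. xs ! (2 * k) < K) \<and>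
     (\<forall>r\<in>set [0..<l]. \<forall>m\<in>set [0..<l].
        \<forall>s\<in>set (end_codes K ps r). \<forall>t\<in>set (end_codes K ps ((r + m) mod l)).
          rainbow_arc ((!) xs) l (set N) r m {s, t} \<or>
          rainbow_arc ((!) xs) l (set N) (r + m) (l - m) {s, t})"

lemma scheme_one_tree: "scheme 6 5 [0] [0, 0] [0,1,2,3,4,6,0,5,3,4,1,2]"
  by code_simp

lemma scheme_adjacent_trees: "scheme 6 5 [0, 1] [0, 1] [0,1,3,4,0,5,2,1,4,6,3,2]"
  by code_simp

lemma scheme_trees_at_distance_two: "scheme 6 5 [0, 2] [0, 2] [0,1,2,3,4,5,0,1,2,3,4,6]"
  by code_simp

lemma scheme_opposite_trees: "scheme 6 6 [0, 3] [0, 0] [0,1,2,3,4,7,5,6,3,4,1,2]"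
  by code_simp

lemma scheme_opposite_trees_and_successor: "scheme 6 6 [0, 1, 3] [1] [0,2,1,3,4,0,2,6,1,5,4,3]"
  by code_simp

lemma scheme_opposite_trees_and_predecessor: "scheme 6 6 [0, 3, 5] [5] [0,3,4,5,1,6,2,0,4,3,1,2]"
  by code_simp

lemma scheme_one_tree_heptagon: "scheme 7 6 [0] [0] [0,1,2,3,4,5,0,6,4,1,3,2,5,4]"
  by code_simp

definition (in rooted_cycle) decode :: "nat \<Rightarrow> 'a list \<Rightarrow> nat \<Rightarrow> 'a color" where
  "decode K as k = (if k < K then Fresh k else pendant (as ! (k - K)))"

context unicyclic
begin

context
  fixes K :: nat and as :: "'a list" and ps :: "nat list"
  assumes as: "distinct as" "set as \<subseteq> leaves" "map root as = map (cyc_nth us) ps"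
begin

lemma length_selected_leaves: "length as = length ps"
  using as(3) map_eq_imp_length_eq by blast

lemma decode_eq_pendant_iff:
  assumes "k < K + length ps" "a \<in> leaves"
  shows "decode K as k = pendant a \<longleftrightarrow> K \<le> k \<and> as ! (k - K) = a"
proof (cases "k < K")
  case False
  then have "k - K < length as" using assms(1) length_selected_leaves by simp
  then have "as ! (k - K) \<in> leaves" using as(2) nth_mem by blast
  then show ?thesis
    using False assms(2) leaves_subset inj_onD[OF inj_on_pendant, of "as ! (k - K)" a]
    by (auto simp: decode_def)
qed (simp add: decode_def pendant_def)

lemma inj_on_decode: "inj_on (decode K as) {..<K + length ps}"
proof (rule inj_onI)
  fix j k
  assume jk: "j \<in> {..<K + length ps}" "k \<in> {..<K + length ps}" "decode K as j = decode K as k"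
  show "j = k"
  proof (cases "k < K")
    case True
    then show ?thesis using jk(3) by (auto simp: decode_def pendant_def split: if_splits)
  next
    case False
    then have "k - K < length as" using jk(2) length_selected_leaves by auto
    then have "as ! (k - K) \<in> leaves" using as(2) nth_mem by blast
    then have "K \<le> j" "as ! (j - K) = as ! (k - K)"
      using decode_eq_pendant_iff[of j "as ! (k - K)"] jk False by (auto simp: decode_def)
    then show ?thesis
      using as(1) jk(1,2) False length_selected_leaves by (auto simp: nth_eq_iff_index_eq)
  qed
qed

lemma ex_end_code:
  assumes "\<And>i. i \<in> set ps \<Longrightarrow> i < length us" and x: "root x = cyc_nth us r" "r < length us"
  obtains s where "s \<in> set (end_codes K ps r)"
    "\<And>k. k < K + length ps \<Longrightarrow> x \<in> leaves \<Longrightarrow> decode K as k = pendant x \<Longrightarrow> k = s"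
proof (cases "x \<in> set as")
  case True
  then obtain j where j: "j < length ps" "x = as ! j"
    by (metis in_set_conv_nth length_selected_leaves)
  then have "root x = cyc_nth us (ps ! j)" using as(3) by (metis length_selected_leaves nth_map)
  then have "ps ! j = r" using x assms(1)[of "ps ! j"] j(1) by (simp add: cyc_nth_eq_iff_mod)
  then have "K + j \<in> set (end_codes K ps r)" using j(1) by (simp add: end_codes_def)
  moreover have "k = K + j" if "k < K + length ps" "x \<in> leaves" "decode K as k = pendant x" for k
    using that decode_eq_pendant_iff[of k x] j length_selected_leaves as(1)
    by (auto simp: nth_eq_iff_index_eq)
  ultimately show ?thesis using that by blast
next
  case False
  have "decode K as k \<noteq> pendant x" if k: "k < K + length ps" "x \<in> leaves" for k
  proof
    assume "decode K as k = pendant x"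
    then have "K \<le> k" "as ! (k - K) = x" using k decode_eq_pendant_iff by auto
    then show False using False k(1) length_selected_leaves by auto
  qed
  then show ?thesis using that[of "K + length ps"] by (simp add: end_codes_def)
qed

context
  fixes N xs :: "nat list"
  assumes scheme: "scheme (length us) K N ps xs"
    and leaf_positions: "root ` leaves \<subseteq> cyc_nth us ` set N"
begin

lemma scheme_letter: "p < 2 * length us \<Longrightarrow> xs ! p < K + length ps"
  using scheme by (simp add: scheme_def)

lemma cycle_word_decode: "cycle_word G us parent depth K (decode K as \<circ> (!) xs) (set N)"
proof unfold_locales
  show "(decode K as \<circ> (!) xs) (2 * k) \<in> Fresh ` {..<K}" if "k < length us" for k
    using scheme that by (simp add: scheme_def decode_def)
  show "(decode K as \<circ> (!) xs) p \<in> Fresh ` {..<K} \<union> pendant ` leaves" if "p < 2 * length us" for p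
    using scheme_letter[OF that] as(2) length_selected_leaves by (auto simp: decode_def subset_iff)
  show "k mod length us \<in> set N" if x: "x \<in> tree_verts" "root x = cyc_nth us k" for x k
  proof -
    have "root x \<in> cyc_nth us ` set N" using x(1) leaf_positions root_leaves by blast
    then obtain i where i: "i \<in> set N" "cyc_nth us k = cyc_nth us i" using x(2) by auto
    then have "i < length us" using scheme by (simp add: scheme_def)
    then show ?thesis using i by (simp add: cyc_nth_eq_iff_mod)
  qed
qed

lemma ex_rainbow_arc_decode:
  assumes "x \<in> pverts G" "y \<in> pverts G"
  shows "\<exists>r m. arc_between us r m (root x) (root y) \<and>
    rainbow_arc (decode K as \<circ> (!) xs) (length us) (set N) r m (pendant ` (leaves \<inter> {x, y}))"
proof -
  have ps: "i < length us" if "i \<in> set ps" for i using scheme that by (simp add: scheme_def)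
  obtain r where r: "r < length us" "root x = cyc_nth us r"
    using ex_root_position[OF assms(1), of 0] by auto
  obtain m where m: "m < length us" "root y = cyc_nth us (r + m)"
    using ex_root_position[OF assms(2)] .
  obtain s where s: "s \<in> set (end_codes K ps r)"
    "\<And>k. k < K + length ps \<Longrightarrow> x \<in> leaves \<Longrightarrow> decode K as k = pendant x \<Longrightarrow> k = s"
    using ex_end_code[OF ps r(2,1)] by metis
  have "root y = cyc_nth us ((r + m) mod length us)" "(r + m) mod length us < length us"
    using m(2) cycle_not_Nil by simp_all
  then obtain t where t: "t \<in> set (end_codes K ps ((r + m) mod length us))"
    "\<And>k. k < K + length ps \<Longrightarrow> y \<in> leaves \<Longrightarrow> decode K as k = pendant y \<Longrightarrow> k = t"
    using ex_end_code[OF ps] by metis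
  have decoded: "rainbow_arc (decode K as \<circ> (!) xs) (length us) (set N) i j
      (pendant ` (leaves \<inter> {x, y}))"
    if "rainbow_arc ((!) xs) (length us) (set N) i j {s, t}" for i j
    by (rule rainbow_arc_comp[OF that inj_on_decode])
      (use scheme_letter cycle_not_Nil s(2) t(2) in auto)
  have "rainbow_arc ((!) xs) (length us) (set N) r m {s, t} \<or>
      rainbow_arc ((!) xs) (length us) (set N) (r + m) (length us - m) {s, t}"
    using scheme r(1) m(1) s(1) t(1) by (simp add: scheme_def)
  moreover have "r + m + (length us - m) = r + length us" using m(1) by simp
  then have "root x = cyc_nth us (r + m + (length us - m))" using r(2) by simp
  ultimately show ?thesis using decoded r(2) m(2) unfolding arc_between_def by blast
qed

lemma trc_le_if_scheme: "trc G + card leaves + 2 * length us \<le> 2 * card (pverts G) + K"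
  using cycle_word.trc_le_if_rainbow_arcs[OF cycle_word_decode] ex_rainbow_arc_decode by blast

end

end

lemma trc_le_if_rotated_scheme:
  assumes "scheme l K N ps xs" "length us = l" "distinct as" "set as \<subseteq> leaves"
    and "map root as = map (\<lambda>i. cyc_nth us (r + i)) ps"
    and "root ` leaves \<subseteq> (\<lambda>i. cyc_nth us (r + i)) ` set N"
  shows "trc G + card leaves + 2 * l \<le> 2 * card (pverts G) + K"
proof -
  interpret R: unicyclic G "rotate r us" parent depth by (rule unicyclic_rotate)
  have "R.leaves = leaves" by (simp add: R.leaves_def leaves_def)
  moreover have "cyc_nth (rotate r us) = (\<lambda>i. cyc_nth us (r + i))"
    using cyc_nth_rotate[OF cycle_not_Nil] by blast
  ultimately show ?thesis
    using R.trc_le_if_scheme[of as ps K N xs] assms by simp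
qed

lemma trc_le_if_long_cycle:
  assumes "leaves \<noteq> {}" "7 \<le> length us"
  shows "trc G + 9 \<le> 2 * card (pverts G)"
proof -
  have "card leaves \<noteq> 0" using assms(1) finite_leaves by simp
  then consider "card leaves = 1" | "2 \<le> card leaves" by linarith
  then show ?thesis
  proof cases
    case 1
    then obtain a where a: "leaves = {a}" by (rule card_1_singletonE)
    then have "a \<in> pverts G" using leaves_subset by blast
    then obtain r where r: "root a = cyc_nth us r" using ex_root_position[of a 0] by auto
    show ?thesis
    proof (cases "length us = 7")
      case True
      then show ?thesis
        using trc_le_if_rotated_scheme[OF scheme_one_tree_heptagon True, of "[a]" r] a r by simp
    next
      case False
      then show ?thesis using trc_le_if_single_leaf[OF a] assms(2) by simp
    qed
  next
    case 2
    show ?thesis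
    proof (cases "even (length us)")
      case True
      then have "8 \<le> length us" using assms(2) by (cases "length us = 7") auto
      then show ?thesis using trc_le_if_even_cycle[OF True] 2 by simp
    next
      case False
      then have "trc G + card leaves + length us \<le> 2 * card (pverts G)"
        by (intro trc_le_if_no_opposite_trees) (metis dvd_triv_left)
      then show ?thesis using 2 assms(2) by simp
    qed
  qed
qed

end

section \<open>Cycles of length six\<close>

context unicyclic
begin

lemma trc_hexagon_two_near_leaves:
  assumes "length us = 6" "leaves = {a, b}" "a \<noteq> b" "d \<le> 2"
    and "root a = cyc_nth us r" "root b = cyc_nth us (r + d)"
  shows "trc G + 9 \<le> 2 * card (pverts G)"
proof -
  consider "d = 0" | "d = 1" | "d = 2" using assms(4) by linarith
  then show ?thesis
  proof cases
    case 1
    then show ?thesis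
      using trc_le_if_rotated_scheme[OF scheme_one_tree assms(1), of "[a, b]" r] assms by simp
  next
    case 2
    then show ?thesis
      using trc_le_if_rotated_scheme[OF scheme_adjacent_trees assms(1), of "[a, b]" r] assms by simp
  next
    case 3
    then show ?thesis
      using trc_le_if_rotated_scheme[OF scheme_trees_at_distance_two assms(1), of "[a, b]" r] assms
      by simp
  qed
qed

lemma trc_hexagon_two_leaves:
  assumes "length us = 6" "leaves = {a, b}" "a \<noteq> b"
    and "root a = cyc_nth us r" "root b \<noteq> cyc_nth us (r + 3)"
  shows "trc G + 9 \<le> 2 * card (pverts G)"
proof -
  have "b \<in> pverts G" using assms(2) leaves_subset by blast
  then obtain d where d: "d < 6" "root b = cyc_nth us (r + d)"
    using ex_root_position[of b r] assms(1) by metis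
  then have "d \<noteq> 3" using assms(5) by auto
  then consider "d \<le> 2" | "4 \<le> d" by linarith
  then show ?thesis
  proof cases
    case 1
    then show ?thesis using trc_hexagon_two_near_leaves[OF assms(1-3)] assms(4) d(2) by blast
  next
    case 2
    then have "r + d + (6 - d) = r + length us" using d(1) assms(1) by simp
    then have "root a = cyc_nth us (r + d + (6 - d))"
      using assms(4) by (simp only: cyc_nth_add_length)
    then show ?thesis
      using trc_hexagon_two_near_leaves[of b a "6 - d" "r + d"] assms(1-3) d(2) 2
      by (simp add: insert_commute)
  qed
qed

lemma trc_hexagon_opposite_leaves_and_near_leaf:
  assumes "length us = 6" "leaves = {a, b, c}" "card leaves = 3" "d \<in> {0, 1, 5}"
    and "root a = cyc_nth us r" "root b = cyc_nth us (r + 3)" "root c = cyc_nth us (r + d)"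
  shows "trc G + 9 \<le> 2 * card (pverts G)"
proof -
  have "a \<noteq> c" using assms(2,3) by (auto simp: card_insert_if split: if_splits)
  consider "d = 0" | "d = 1" | "d = 5" using assms(4) by blast
  then show ?thesis
  proof cases
    case 1
    then show ?thesis
      using trc_le_if_rotated_scheme[OF scheme_opposite_trees assms(1), of "[a, c]" r] assms \<open>a \<noteq> c\<close>
      by simp
  next
    case 2
    then show ?thesis
      using trc_le_if_rotated_scheme[OF scheme_opposite_trees_and_successor assms(1), of "[c]" r]
        assms by simp
  next
    case 3
    then show ?thesis
      using trc_le_if_rotated_scheme[OF scheme_opposite_trees_and_predecessor assms(1), of "[c]" r]
        assms by simp
  qed
qed

lemma trc_hexagon_three_leaves_two_opposite:
  assumes "length us = 6" "leaves = {a, b, c}" "card leaves = 3"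
    and "root a = cyc_nth us r" "root b = cyc_nth us (r + 3)"
  shows "trc G + 9 \<le> 2 * card (pverts G)"
proof -
  have "c \<in> pverts G" using assms(2) leaves_subset by blast
  then obtain d where d: "d < 6" "root c = cyc_nth us (r + d)"
    using ex_root_position[of c r] assms(1) by metis
  then consider "d \<in> {0, 1, 5}" | "d = 2" | "3 \<le> d" "d - 3 \<in> {0, 1}" by fastforce
  then show ?thesis
  proof cases
    case 1
    then show ?thesis
      using trc_hexagon_opposite_leaves_and_near_leaf[OF assms(1-3)] assms(4,5) d(2) by blast
  next
    case 2
    then have "r + 3 + 3 = r + length us" "r + 3 + 5 = r + d + length us" using assms(1) by simp_all
    then have "root a = cyc_nth us (r + 3 + 3)" "root c = cyc_nth us (r + 3 + 5)"
      using assms(4) d(2) by (simp_all only: cyc_nth_add_length)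
    then show ?thesis
      using trc_hexagon_opposite_leaves_and_near_leaf[of b a c 5 "r + 3"] assms
      by (simp add: insert_commute)
  next
    case 3
    then have "r + 3 + 3 = r + length us" "r + 3 + (d - 3) = r + d" using assms(1) by simp_all
    then have "root a = cyc_nth us (r + 3 + 3)" "root c = cyc_nth us (r + 3 + (d - 3))"
      using assms(4) d(2) by (simp_all only: cyc_nth_add_length)
    moreover have "d - 3 \<in> {0, 1, 5}" using 3(2) by blast
    ultimately show ?thesis
      using trc_hexagon_opposite_leaves_and_near_leaf[of b a c "d - 3" "r + 3"] assms
      by (simp add: insert_commute)
  qed
qed

lemma trc_hexagon_three_leaves:
  assumes "length us = 6" "card leaves = 3"
  shows "trc G + 9 \<le> 2 * card (pverts G)"
proof (cases "\<exists>r. cyc_nth us r \<in> root ` leaves \<and> cyc_nth us (r + 3) \<in> root ` leaves")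
  case False
  then have "trc G + card leaves + length us \<le> 2 * card (pverts G)"
  proof (intro trc_le_if_no_opposite_trees)
    fix r m assume "2 * m = length us" "cyc_nth us r \<in> root ` leaves"
    moreover from this have "m = 3" using assms(1) by simp
    ultimately show "cyc_nth us (r + m) \<notin> root ` leaves" using False by blast
  qed
  then show ?thesis using assms by simp
next
  case True
  then obtain r where "cyc_nth us r \<in> root ` leaves" "cyc_nth us (r + 3) \<in> root ` leaves" by blast
  then obtain a b where a: "a \<in> leaves" "root a = cyc_nth us r"
    and b: "b \<in> leaves" "root b = cyc_nth us (r + 3)" by (elim imageE) auto
  then have "root a \<noteq> root b"
    using assms(1) cyc_nth_add_eq_self_iff[of 3 r] by simp
  then have "a \<noteq> b" by blast
  then have "card (leaves - {a, b}) = 1" using assms(2) a(1) b(1) by (auto simp: card_Diff_subset)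
  then obtain c where "leaves - {a, b} = {c}" by (metis card_1_singletonE)
  then have "leaves = {a, b, c}" using a(1) b(1) by blast
  then show ?thesis
    using trc_hexagon_three_leaves_two_opposite[OF assms(1) _ assms(2)] a(2) b(2) by blast
qed

lemma trc_le_if_hexagon:
  assumes "length us = 6" "leaves \<noteq> {}"
  shows "trc G + 7 \<le> 2 * card (pverts G)"
proof (cases "card leaves = 1")
  case True
  then obtain a where "leaves = {a}" by (rule card_1_singletonE)
  then show ?thesis using trc_le_if_single_leaf assms(1) by fastforce
next
  case False
  moreover have "card leaves \<noteq> 0" using assms(2) finite_leaves by simp
  ultimately show ?thesis using trc_le_if_even_cycle assms(1) by simp
qed

lemma trc_hexagon_cases:
  assumes "length us = 6" "leaves \<noteq> {}"
  obtains (single) a where "leaves = {a}"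
    | (opposite) a b r where "leaves = {a, b}" "root a = cyc_nth us r" "root b = cyc_nth us (r + 3)"
    | (other) "trc G + 9 \<le> 2 * card (pverts G)"
proof -
  have "card leaves \<noteq> 0" using assms(2) finite_leaves by simp
  then consider "card leaves = 1" | "card leaves = 2" | "card leaves = 3" | "4 \<le> card leaves"
    by linarith
  then show ?thesis
  proof cases
    case 1
    then show ?thesis using single by (metis card_1_singletonE)
  next
    case 2
    then obtain a b where ab: "leaves = {a, b}" "a \<noteq> b" by (auto simp: card_2_iff)
    then have "a \<in> pverts G" using leaves_subset by blast
    then obtain r where "root a = cyc_nth us r" using ex_root_position[of a 0] by auto
    then show ?thesis using ab opposite other trc_hexagon_two_leaves[OF assms(1)] by blast
  next
    case 3
    then show ?thesis using other trc_hexagon_three_leaves[OF assms(1)] by blast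
  next
    case 4
    then show ?thesis using other trc_le_if_even_cycle assms(1) by simp
  qed
qed

end

section \<open>The extremal graphs\<close>

definition ring_dist :: "nat \<Rightarrow> nat \<Rightarrow> nat" where
  "ring_dist l k = min (k mod l) (l - k mod l)"

lemma ring_dist_Suc:
  assumes "0 < l"
  shows "ring_dist l (Suc k) \<le> ring_dist l k + 1" "ring_dist l k \<le> ring_dist l (Suc k) + 1"
  using assms mod_less_divisor[OF assms, of k] by (auto simp: ring_dist_def mod_Suc min_def)

context unicyclic
begin

text \<open>The length is bounded by a potential that changes by at most one along every edge.\<close>

lemma vwalk_length_ge:
  assumes V: "x \<in> pverts G" "y \<in> pverts G"
    and roots: "root x = cyc_nth us r" "root y = cyc_nth us (r + m)" "0 < m" "m < length us"
    and p: "vwalk p G" "hd p = x" "last p = y"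
  shows "depth x + depth y + ring_dist (length us) m \<le> vwalk_length p"
proof -
  let ?l = "length us"
  define pos where "pos = the_inv_into {..<?l} (\<lambda>k. cyc_nth us (r + k))"
  have pos: "pos (cyc_nth us (r + k)) = k mod ?l" for k
  proof -
    have "inj_on (\<lambda>k. cyc_nth us (r + k)) {..<?l}"
      using cyc_nth_add_eq_iff[OF distinct_cycle] by (intro inj_onI) simp
    moreover have "cyc_nth us (r + k) = cyc_nth us (r + k mod ?l)"
      by (simp add: cyc_nth_def mod_add_right_eq)
    ultimately show ?thesis unfolding pos_def using cycle_not_Nil by (intro the_inv_into_f_eq) auto
  qed
  define h where "h v = (if root v = cyc_nth us r then - int (depth v)
    else int (ring_dist ?l (pos (root v))) + int (depth v))" for v
  have h_cycle: "h (cyc_nth us (r + k)) = int (ring_dist ?l k)" for k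
    using pos[of k] pos[of 0] cycle_not_Nil by (auto simp: h_def depth_cycle ring_dist_def)
  have h_parent: "\<bar>h v - h (parent v)\<bar> \<le> 1" if "v \<in> tree_verts" for v
    using depth_parent[OF that] root_parent[OF that] by (simp add: h_def)
  have "h w \<le> h v + 1" if "(v, w) \<in> parcs G" for v w
    using that
  proof (cases rule: arc_cases)
    case cycle
    then have "{v, w} \<in> cycle_edges (rotate r us)"
      using cycle_edges_rotate[OF cycle_not_Nil] by simp
    then obtain k where k: "{v, w} = {cyc_nth us (r + k), cyc_nth us (r + Suc k)}"
      using cycle_not_Nil by (auto simp: cycle_edges_eq_range cyc_nth_rotate)
    have "\<bar>h (cyc_nth us (r + k)) - h (cyc_nth us (r + Suc k))\<bar> \<le> 1"
      unfolding h_cycle using ring_dist_Suc[of ?l k] cycle_not_Nil by simp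
    then show ?thesis using k by (auto simp: doubleton_eq_iff)
  qed (use h_parent in fastforce)+
  then have "h y - h x \<le> int (vwalk_length p)" using vwalk_potential_le[OF p(1)] p(2,3) by blast
  moreover have "root y \<noteq> cyc_nth us r"
    using roots cyc_nth_add_eq_self_iff by simp
  then have "h y = int (ring_dist ?l m) + int (depth y)"
    using pos[of m] roots by (simp add: h_def ring_dist_def)
  moreover have "h x = - int (depth x)" using roots(1) by (simp add: h_def)
  ultimately show ?thesis by linarith
qed

lemma gdist_ge:
  assumes "connected G" "x \<in> pverts G" "y \<in> pverts G"
    and "root x = cyc_nth us r" "root y = cyc_nth us (r + m)" "0 < m" "m < length us"
  shows "depth x + depth y + ring_dist (length us) m \<le> gdist G x y"
  by (rule le_gdistI[OF assms(1-3)]) (use vwalk_length_ge[OF assms(2-7)] in blast)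

lemma stem_eq_if_vpath_to_cycle:
  assumes "vpath p G" "last p \<in> set us" "set (butlast p) \<inter> set us = {}"
  shows "stem (hd p) = p"
  using assms
proof (induct p)
  case (Cons x q)
  show ?case
  proof (cases "q = []")
    case True
    then show ?thesis using Cons.prems(2) by (simp add: stem_cycle)
  next
    case False
    then have q: "vpath q G" "x \<notin> set q" "(x, hd q) \<in> parcs G"
      using Cons.prems(1) vwalk_consE[of x q "with_proj G"] by (auto simp: vpath_def)
    then have stem: "stem (hd q) = q" using Cons False by simp
    have "x \<notin> set us" using Cons.prems(3) False by simp
    from q(3) show ?thesis
    proof (cases rule: arc_cases)
      case cycle
      then show ?thesis using \<open>x \<notin> set us\<close> Union_cycle_edges[OF cycle_not_Nil] by blast
    next
      case up
      then show ?thesis using stem by (simp add: stem_tree)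
    next
      case down
      then have "x \<in> set q"
        using stem stem_tree[OF down(1)] by (metis list.set_intros(2) self_in_stem)
      then show ?thesis using q(2) by blast
    qed
  qed
qed (simp add: vpath_def vwalk_def)

lemma single_leaf_in_B6:
  assumes "length us = 6" "leaves = {a}"
  shows "G \<in> B6 (card (pverts G))"
proof -
  have a: "a \<in> tree_verts" using assms(2) leaves_subset by blast
  then have "a \<in> pverts G" by blast
  then obtain r where r: "root a = cyc_nth us r" using ex_root_position[of a 0] by auto
  let ?us = "rotate r us" and ?p = "rev (stem a)"
  have "hd ?us = root a"
    using r cycle_not_Nil by (simp add: hd_rotate_conv_nth cyc_nth_def)
  moreover have "tree_verts = set (stem a) - set us" using tree_verts_eq_stems assms(2) by simp
  then have "pverts G = set ?us \<union> set ?p" "uedges G = cycle_edges ?us \<union> set (path_edges ?p)"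
    using cycle_in_verts stem_in_verts[OF \<open>a \<in> pverts G\<close>] uedges_eq
      path_edges_stem[OF \<open>a \<in> pverts G\<close>] cycle_edges_rotate[OF cycle_not_Nil]
    by (auto simp: set_path_edges_rev)
  moreover have "set ?us \<inter> set ?p = {root a}" using stem_Int_cycle[OF \<open>a \<in> pverts G\<close>] by auto
  moreover have "2 \<le> length ?p" "distinct ?p" "hd ?p = root a"
    using depth_parent[OF a] distinct_stem[OF \<open>a \<in> pverts G\<close>] by (simp_all add: hd_rev)
  moreover have "length ?us = 6" "distinct ?us" using assms(1) distinct_cycle by simp_all
  ultimately show ?thesis
    unfolding B6_def using pair_graph by (intro CollectI conjI exI[of _ ?us] exI[of _ ?p]) simp_all
qed

lemma root_eq_if_arc_off_cycle:
  assumes "(v, w) \<in> parcs G" "{v, w} \<notin> cycle_edges us"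
  shows "root v = root w"
  using assms(1) by (cases rule: arc_cases) (use assms(2) root_parent in auto)

lemma reachable_off_cycle:
  assumes "u \<in> set us"
  shows "{v. u \<rightarrow>\<^sup>*\<^bsub>with_proj (del_cycle_edges G us)\<^esub> v} = {v \<in> pverts G. root v = u}"
proof -
  let ?H = "with_proj (del_cycle_edges G us)"
  have H: "verts ?H = pverts G" "arcs_ends ?H = {(v, w) \<in> parcs G. {v, w} \<notin> cycle_edges us}"
    by (auto simp: del_cycle_edges_def edge_of_def)
  have "v \<in> pverts G \<and> root v = u" if "u \<rightarrow>\<^sup>*\<^bsub>?H\<^esub> v" for v
    using that unfolding reachable_def H
  proof (induct rule: rtrancl_on_induct)
    case (step v w)
    then show ?case using root_eq_if_arc_off_cycle[of v w] by auto
  qed (use assms in auto)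
  moreover have "root v \<rightarrow>\<^sup>*\<^bsub>?H\<^esub> v" if "v \<in> pverts G" for v
    using that
  proof (induct v rule: tree_induct)
    case (cycle v)
    then show ?case unfolding reachable_def H(1) using cycle_in_verts by auto
  next
    case (tree v)
    have "(parent v, v) \<in> arcs_ends ?H"
      unfolding H(2)
      using arcs_symmetric[OF parent_arc[OF tree(1)]] up_edge_notin_cycle_edges[OF tree(1)]
      by (simp add: insert_commute)
    then have "root (parent v) \<rightarrow>\<^sup>*\<^bsub>?H\<^esub> v"
      using tree unfolding reachable_def H(1) by (auto intro: rtrancl_on_into_rtrancl_on)
    then show ?case using root_parent[OF tree(1)] by simp
  qed
  ultimately show ?thesis by blast
qed

lemma verts_hanging_tree:
  "u \<in> set us \<Longrightarrow> verts (hanging_tree G us u) = {v \<in> pverts G. root v = u}"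
  by (simp add: hanging_tree_def reachable_off_cycle)

lemma inj_on_hanging_tree: "inj_on (hanging_tree G us) (set us)"
proof (rule inj_onI)
  fix u v assume uv: "u \<in> set us" "v \<in> set us" "hanging_tree G us u = hanging_tree G us v"
  then have "u \<in> verts (hanging_tree G us v)"
    using verts_hanging_tree[OF uv(1)] cycle_in_verts by auto
  then show "u = v" using verts_hanging_tree[OF uv(2)] uv(1) by simp
qed

lemma nontrivial_hanging_tree_iff:
  assumes "u \<in> set us"
  shows "nontrivial (hanging_tree G us u) \<longleftrightarrow> u \<in> root ` tree_verts"
proof -
  have "arcs (hanging_tree G us u) =
      {(v, w) \<in> parcs G. {v, w} \<notin> cycle_edges us \<and> root v = u \<and> root w = u}"
    unfolding hanging_tree_def Let_def reachable_off_cycle[OF assms] induce_subgraph_arcs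
    using in_arcsD1 in_arcsD2 by (auto simp: del_cycle_edges_def edge_of_def)
  then have "nontrivial (hanging_tree G us u) \<longleftrightarrow>
      (\<exists>v w. (v, w) \<in> parcs G \<and> {v, w} \<notin> cycle_edges us \<and> root v = u \<and> root w = u)"
    by (auto simp: nontrivial_def)
  also have "\<dots> \<longleftrightarrow> (\<exists>v\<in>tree_verts. root v = u)"
  proof
    assume "\<exists>v w. (v, w) \<in> parcs G \<and> {v, w} \<notin> cycle_edges us \<and> root v = u \<and> root w = u"
    then obtain v w where "(v, w) \<in> parcs G" "{v, w} \<notin> cycle_edges us" "root v = u" "root w = u"
      by blast
    then show "\<exists>v\<in>tree_verts. root v = u" by (cases rule: arc_cases) auto
  next
    assume "\<exists>v\<in>tree_verts. root v = u"
    then obtain v where "v \<in> tree_verts" "root v = u" by blast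
    then show "\<exists>v w. (v, w) \<in> parcs G \<and> {v, w} \<notin> cycle_edges us \<and> root v = u \<and> root w = u"
      using parent_arc up_edge_notin_cycle_edges root_parent
      by (intro exI[of _ v] exI[of _ "parent v"]) simp
  qed
  finally show ?thesis by blast
qed

lemma card_nontrivial_hanging_trees:
  "card {T \<in> hanging_trees G us. nontrivial T} = card (root ` leaves)"
proof -
  have "{T \<in> hanging_trees G us. nontrivial T} = hanging_tree G us ` root ` leaves"
    using nontrivial_hanging_tree_iff root_in_cycle unfolding hanging_trees_def root_leaves by blast
  moreover have "root ` leaves \<subseteq> set us" using root_in_cycle leaves_subset by blast
  then have "inj_on (hanging_tree G us) (root ` leaves)"
    using inj_on_hanging_tree by (rule inj_on_subset[rotated])
  ultimately show ?thesis by (simp add: card_image)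
qed

lemma card_tree_verts:
  assumes "inj_on root leaves"
  shows "card tree_verts = (\<Sum>a\<in>leaves. depth a)"
proof -
  have leaf_in_verts: "a \<in> pverts G" if "a \<in> leaves" for a using that leaves_subset by blast
  have "set (stem a) \<inter> set (stem b) = {}" if "a \<in> leaves" "b \<in> leaves" "a \<noteq> b" for a b
    using root_eq_if_in_stem leaf_in_verts inj_onD[OF assms] that by (metis disjoint_iff)
  then have "card tree_verts = (\<Sum>a\<in>leaves. card (set (stem a) - set us))"
    unfolding tree_verts_eq_stems using finite_leaves by (intro card_UN_disjoint) auto
  also have "\<dots> = (\<Sum>a\<in>leaves. depth a)" using leaf_in_verts card_stem by (intro sum.cong) auto
  finally show ?thesis .
qed

lemma opposite_leaves_in_J1:
  assumes "connected_unicyclic G" "length us = 6" "leaves = {a, b}"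
    and "root a = cyc_nth us r" "root b = cyc_nth us (r + 3)"
  shows "G \<in> J1 (card (pverts G))"
proof -
  have conn: "connected G" using assms(1) by (simp add: connected_unicyclic_def)
  have ab: "a \<in> pverts G" "b \<in> pverts G" using assms(3) leaves_subset by blast+
  have "root a \<noteq> root b"
    using assms(2,4,5) cyc_nth_add_eq_self_iff[of 3 r] by simp
  then have "a \<noteq> b" "inj_on root leaves" using assms(3) by auto
  then have "card (pverts G) = 6 + depth a + depth b"
    using card_verts card_tree_verts assms(2,3) by simp
  also have "\<dots> \<le> diam G + 3"
    using gdist_ge[OF conn ab assms(4,5)] gdist_le_diam[OF ab] assms(2)
    by (simp add: ring_dist_def)
  finally have "card (pverts G) \<le> diam G + 3" .
  moreover have "diam G + 3 \<le> card (pverts G)"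
    using trc_le_if_hexagon[OF assms(2)] diam_le_trc[OF conn] assms(3) by simp
  ultimately have "int (diam G) = int (card (pverts G)) - 3" by simp
  moreover have "card {T \<in> hanging_trees G us. nontrivial T} = 2"
    using card_nontrivial_hanging_trees \<open>root a \<noteq> root b\<close> assms(3) by simp
  ultimately show ?thesis using assms(1,2) cyc unfolding J1_def by blast
qed

lemma leaves_nonempty:
  assumes "\<not> is_cycle_graph G"
  shows "leaves \<noteq> {}"
proof
  assume "leaves = {}"
  then have "tree_verts = {}" using tree_verts_eq_stems by simp
  then have "pverts G = set us" "uedges G = cycle_edges us" using cycle_in_verts uedges_eq by auto
  then show False using assms cyc unfolding is_cycle_graph_def by blast
qed

end

lemma B6_hexagon:
  assumes "G \<in> B6 n"
  obtains us p where "ucycle G us" "length us = 6" "vpath (rev p) G" "hd p = hd us"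
    "set us \<inter> set p = {hd us}" "n = 5 + length p"
proof -
  obtain us p where "pair_graph G" and n: "card (pverts G) = n"
    and us: "length us = 6" "distinct us"
    and p: "2 \<le> length p" "distinct p" "hd p = hd us" "set us \<inter> set p = {hd us}"
    and V: "pverts G = set us \<union> set p" and E: "uedges G = cycle_edges us \<union> set (path_edges p)"
    using assms unfolding B6_def by blast
  interpret pair_graph G by fact
  have "ucycle G us" using us V E by (simp add: ucycle_iff)
  moreover have "vpath (rev p) G"
    using p V E by (auto simp: vpath_def vwalk_iff_uedges set_path_edges_rev)
  moreover have "n = 5 + length p"
    using card_Un_Int[of "set us" "set p"] n us p by (simp add: V distinct_card)
  ultimately show ?thesis using that us(1) p(3,4) by blast
qed

lemma B6_diam:
  assumes "connected_unicyclic G" "G \<in> B6 n"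
  shows "n \<le> diam G + 3"
proof -
  obtain us p where us: "ucycle G us" "length us = 6" and p: "vpath (rev p) G"
    "hd p = hd us" "set us \<inter> set p = {hd us}" and n: "n = 5 + length p"
    using B6_hexagon[OF assms(2)] .
  obtain parent depth where "unicyclic G us parent depth"
    using connected_unicyclic_imp_unicyclic[OF assms(1) us(1)] .
  then interpret unicyclic G us parent depth .
  have ne: "p \<noteq> []" "distinct p" using p(1) by (auto simp: vpath_def)
  have "set (butlast (rev p)) = set p - {hd p}" using ne by (cases p) (auto simp: butlast_append)
  then have stem: "stem (last p) = rev p"
    using stem_eq_if_vpath_to_cycle[OF p(1)] p(2,3) ne cycle_not_Nil by (auto simp: last_rev hd_rev)
  then have "length p = Suc (depth (last p))" using length_stem[of "last p"] by simp
  have last: "last p \<in> pverts G" using p(1) ne by (auto simp: vpath_def vwalk_def)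
  have opposite: "cyc_nth us 3 \<in> set us" using cycle_not_Nil by simp
  then have opposite_vert: "cyc_nth us 3 \<in> pverts G" using cycle_in_verts by blast
  have "root (last p) = cyc_nth us 0"
    using last_stem[of "last p"] stem ne p(2) cycle_not_Nil
    by (simp add: last_rev cyc_nth_def hd_conv_nth)
  then have "depth (last p) + depth (cyc_nth us 3) + 3 \<le> gdist G (last p) (cyc_nth us 3)"
    using gdist_ge[OF _ last opposite_vert, of 0 3] opposite assms(1) us(2)
    by (simp add: connected_unicyclic_def ring_dist_def)
  also have "\<dots> \<le> diam G" by (rule gdist_le_diam[OF last opposite_vert])
  finally show ?thesis using n \<open>length p = _\<close> by simp
qed

lemma extremal_hexagon:
  assumes "connected_unicyclic G" "ucycle G us" "G \<in> B6 n \<union> J1 n"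
  shows "length us = 6"
proof -
  have "\<exists>vs. ucycle G vs \<and> length vs = 6"
    using assms(3) by (auto simp: J1_def elim: B6_hexagon)
  then show ?thesis using unique_cycle_length[OF assms(1,2)] by metis
qed

lemma extremal_diam:
  assumes "connected_unicyclic G" "G \<in> B6 n \<union> J1 n"
  shows "n \<le> diam G + 3"
  using assms B6_diam by (auto simp: J1_def)

context unicyclic
begin

lemma trc_eq_if_extremal:
  assumes "connected_unicyclic G" "leaves \<noteq> {}" "G \<in> B6 (card (pverts G)) \<union> J1 (card (pverts G))"
  shows "trc G + 7 = 2 * card (pverts G)"
proof -
  have "2 * diam G \<le> trc G + 1"
    using diam_le_trc assms(1) by (simp add: connected_unicyclic_def)
  then show ?thesis
    using trc_le_if_hexagon[OF extremal_hexagon[OF assms(1) cyc assms(3)] assms(2)]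
      extremal_diam[OF assms(1,3)] by linarith
qed

lemma trc_le_if_not_extremal:
  assumes "connected_unicyclic G" "leaves \<noteq> {}" "6 \<le> length us"
    and "G \<notin> B6 (card (pverts G)) \<union> J1 (card (pverts G))"
  shows "trc G + 9 \<le> 2 * card (pverts G)"
proof (cases "length us = 6")
  case True
  from True assms(2) show ?thesis
  proof (cases rule: trc_hexagon_cases)
    case (single a)
    then show ?thesis using single_leaf_in_B6[OF True] assms(4) by blast
  next
    case (opposite a b r)
    then show ?thesis using opposite_leaves_in_J1[OF assms(1) True] assms(4) by blast
  qed
next
  case False
  then show ?thesis using trc_le_if_long_cycle[OF assms(2)] assms(3) by simp
qed

end

theorem theorem3p3:
  fixes G :: "'a pair_pre_digraph" and us :: "'a list" and n :: nat
  assumes "connected_unicyclic G"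
    and "card (pverts G) = n"
    and "\<not> is_cycle_graph G"
    and "ucycle G us"
    and "length us \<ge> 6"
  shows "(G \<in> B6 n \<union> J1 n \<longrightarrow> int (trc G) = 2 * int n - 7) \<and>
         (G \<notin> B6 n \<union> J1 n \<longrightarrow> int (trc G) \<le> 2 * int n - 9)"
proof -
  obtain parent depth where "unicyclic G us parent depth"
    using connected_unicyclic_imp_unicyclic[OF assms(1,4)] .
  then interpret unicyclic G us parent depth .
  have leaves: "leaves \<noteq> {}" using leaves_nonempty[OF assms(3)] .
  have "trc G + 7 = 2 * n" if "G \<in> B6 n \<union> J1 n"
    using trc_eq_if_extremal[OF assms(1) leaves] that assms(2) by simp
  moreover have "trc G + 9 \<le> 2 * n" if "G \<notin> B6 n \<union> J1 n"
    using trc_le_if_not_extremal[OF assms(1) leaves assms(5)] that assms(2) by simp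
  ultimately show ?thesis by fastforce
qed

end
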